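(* Let $\Omega$ be a locally compact Hausdorff space, $E$ a Banach space and $\mathscr{K}$ a convex subset of $C_0(\Omega,E)$. In each of the three cases specified below, the norm closure of $\mathscr{K}$ coincides with the set of all functions $f\in C_0(\Omega,E)$ such that $f|_L\in\mathscr{M}(\mathscr{K}|_L)$ for every compact set $L\subset\Omega$, where $\mathscr{K}|_L=\{g|_L\in C(L,E) : g\in\mathscr{K}\}$: (1) $\Omega$ is compact; or (2) $\mathscr{K}$ is bounded; or (3) $E$ is a $C^*$-algebra and $\mathscr{K}$ is a $*$-subalgebra of $C_0(\Omega,E)$.
   Context: Banach spaces are over a fixed field $\mathbb{K}$ of real or complex numbers. $C_0(\Omega,E)$ is the Banach space of continuous functions $\Omega\to E$ vanishing at infinity, with the sup-norm; $C(L,E)$ is the space of continuous functions $L\to E$. For a set $Z$, $\ell_\infty(Z,E)$ is the Banach space of all bounded functions $Z\to E$ with the sup-norm. For $A\subset\ell_\infty(Z,E)$, $\mathscr{M}(A)$ denotes the smallest set among all $B\subset\ell_\infty(Z,E)$ such that: (M0) $A\subset B$; (M1) whenever $f_n\in B$ are uniformly bounded and converge pointwise to $f\in\ell_\infty(Z,E)$ in the weak topology of $E$, then $f\in B$. Here $\mathscr{M}(\mathscr{K}|_L)$ is formed in $\ell_\infty(L,E)$. *)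

theory Defs
  imports "HOL-Analysis.Analysis"
begin

(* Type class of the two scalar fields \<real> and \<complex>: a normed field together with an isometric
   embedding of it into the complex numbers whose range is the real line or everything. *)
class real_or_complex = real_normed_field +
  fixes to_complex :: "'a \<Rightarrow> complex"
  assumes to_complex_add: "to_complex (x + y) = to_complex x + to_complex y"
    and to_complex_mult: "to_complex (x * y) = to_complex x * to_complex y"
    and to_complex_scaleR: "to_complex (r *\<^sub>R x) = r *\<^sub>R to_complex x"
    and norm_to_complex: "norm (to_complex x) = norm x"
    and range_to_complex: "range to_complex = \<real> \<or> range to_complex = UNIV"

instantiation real :: real_or_complex
begin
definition to_complex_real :: "real \<Rightarrow> complex" where "to_complex_real = complex_of_real"
instance
  by standard (auto simp: to_complex_real_def Reals_def scaleR_conv_of_real)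
end

instantiation complex :: real_or_complex
begin
definition to_complex_complex :: "complex \<Rightarrow> complex" where "to_complex_complex = id"
instance
  by standard (auto simp: to_complex_complex_def)
end

(* A Banach space over the field 'k. The type class banach provides the norm, its completeness
   and the real scalar multiplication, which smul has to extend. *)
locale banach_space_over = vector_space smul
  for smul :: "'k::real_or_complex \<Rightarrow> 'e::banach \<Rightarrow> 'e" +
  assumes norm_scale: "norm (smul c x) = norm c * norm x"
    and scale_of_real: "smul (of_real r) x = r *\<^sub>R x"

definition dual_space :: "('k::real_or_complex \<Rightarrow> 'e::banach \<Rightarrow> 'e) \<Rightarrow> ('e \<Rightarrow> 'k) set" where
  "dual_space smul = {\<phi>. Vector_Spaces.linear smul (*) \<phi> \<and> continuous_on UNIV \<phi>}"

definition weak_topology :: "('k::real_or_complex \<Rightarrow> 'e::banach \<Rightarrow> 'e) \<Rightarrow> 'e topology" where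
  "weak_topology smul =
     topology_generated_by {\<phi> -` U | \<phi> U. \<phi> \<in> dual_space smul \<and> open U}"

definition C0 :: "('a::topological_space \<Rightarrow>\<^sub>C 'e::real_normed_vector) set" where
  "C0 = {f. \<forall>e>0. \<exists>S. compact S \<and> (\<forall>x. x \<notin> S \<longrightarrow> norm (apply_bcontfun f x) < e)}"

(* Functions on the subset Z are represented extensionally, i.e. they are undefined outside Z. *)
definition linfty :: "'z set \<Rightarrow> ('z \<Rightarrow> 'e::real_normed_vector) set" where
  "linfty Z = {f \<in> Z \<rightarrow>\<^sub>E UNIV. bounded (f ` Z)}"

definition weakly_seq_closed ::
  "('k::real_or_complex \<Rightarrow> 'e::banach \<Rightarrow> 'e) \<Rightarrow> 'z set \<Rightarrow> ('z \<Rightarrow> 'e) set \<Rightarrow> bool" where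
  "weakly_seq_closed smul Z B \<longleftrightarrow>
     (\<forall>(f :: nat \<Rightarrow> 'z \<Rightarrow> 'e) g.
        (\<forall>n. f n \<in> B) \<and> (\<exists>C. \<forall>n. \<forall>z\<in>Z. norm (f n z) \<le> C) \<and> g \<in> linfty Z \<and>
        (\<forall>z\<in>Z. limitin (weak_topology smul) (\<lambda>n. f n z) (g z) sequentially)
        \<longrightarrow> g \<in> B)"

(* \<M>(A), the smallest set satisfying (M0) and (M1), formed in linfty Z, for A \<subseteq> linfty Z *)
definition M_hull ::
  "('k::real_or_complex \<Rightarrow> 'e::banach \<Rightarrow> 'e) \<Rightarrow> 'z set \<Rightarrow> ('z \<Rightarrow> 'e) set \<Rightarrow> ('z \<Rightarrow> 'e) set" where
  "M_hull smul Z A = (\<lambda>B. B \<subseteq> linfty Z \<and> weakly_seq_closed smul Z B) hull A"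

lemma M_hull_smallest:
  fixes smul :: "'k::real_or_complex \<Rightarrow> 'e::banach \<Rightarrow> 'e" and A :: "('z \<Rightarrow> 'e) set"
  assumes "A \<subseteq> linfty Z"
  shows "A \<subseteq> M_hull smul Z A" "M_hull smul Z A \<subseteq> linfty Z"
    and "weakly_seq_closed smul Z (M_hull smul Z A)"
    and "\<And>B. A \<subseteq> B \<Longrightarrow> B \<subseteq> linfty Z \<Longrightarrow> weakly_seq_closed smul Z B \<Longrightarrow> M_hull smul Z A \<subseteq> B"
proof -
  show "A \<subseteq> M_hull smul Z A"
    unfolding M_hull_def by (rule hull_subset)
  have "weakly_seq_closed smul Z (linfty Z)"
    by (auto simp: weakly_seq_closed_def)
  then show "M_hull smul Z A \<subseteq> linfty Z"
    unfolding M_hull_def using assms by (intro hull_minimal) auto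
  show "M_hull smul Z A \<subseteq> B"
    if "A \<subseteq> B" "B \<subseteq> linfty Z" "weakly_seq_closed smul Z B" for B
    unfolding M_hull_def using that by (intro hull_minimal) auto
  show "weakly_seq_closed smul Z (M_hull smul Z A)"
    unfolding weakly_seq_closed_def
  proof (intro allI impI, elim conjE)
    fix f :: "nat \<Rightarrow> 'z \<Rightarrow> 'e" and g
    assume *: "\<forall>n. f n \<in> M_hull smul Z A" "\<exists>C. \<forall>n. \<forall>z\<in>Z. norm (f n z) \<le> C" "g \<in> linfty Z"
      "\<forall>z\<in>Z. limitin (weak_topology smul) (\<lambda>n. f n z) (g z) sequentially"
    show "g \<in> M_hull smul Z A"
      unfolding M_hull_def hull_def
    proof (intro InterI, elim CollectE conjE)
      fix B assume B: "B \<subseteq> linfty Z" "weakly_seq_closed smul Z B" "A \<subseteq> B"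
      have "\<forall>n. f n \<in> B"
        using *(1) B unfolding M_hull_def hull_def by blast
      then show "g \<in> B"
        using *(2-4) B(2) unfolding weakly_seq_closed_def by blast
    qed
  qed
qed

(* C*-algebras are complex and need not have a unit. *)
locale cstar_algebra = banach_space_over smul
  for smul :: "complex \<Rightarrow> 'e::banach \<Rightarrow> 'e" +
  fixes amul :: "'e \<Rightarrow> 'e \<Rightarrow> 'e"
    and star :: "'e \<Rightarrow> 'e"
  assumes mult_assoc: "amul (amul x y) z = amul x (amul y z)"
    and mult_add_left: "amul (x + y) z = amul x z + amul y z"
    and mult_add_right: "amul x (y + z) = amul x y + amul x z"
    and mult_scale_left: "amul (smul c x) y = smul c (amul x y)"
    and mult_scale_right: "amul x (smul c y) = smul c (amul x y)"
    and norm_mult_le: "norm (amul x y) \<le> norm x * norm y"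
    and star_star: "star (star x) = x"
    and star_add: "star (x + y) = star x + star y"
    and star_scale: "star (smul c x) = smul (cnj c) (star x)"
    and star_mult: "star (amul x y) = amul (star y) (star x)"
    and cstar_identity: "norm (amul (star x) x) = (norm x)\<^sup>2"

(* *-subalgebras of C0, all operations being pointwise *)
definition star_subalgebra_C0 ::
  "(complex \<Rightarrow> 'e::banach \<Rightarrow> 'e) \<Rightarrow> ('e \<Rightarrow> 'e \<Rightarrow> 'e) \<Rightarrow> ('e \<Rightarrow> 'e)
     \<Rightarrow> ('a::topological_space \<Rightarrow>\<^sub>C 'e) set \<Rightarrow> bool" where
  "star_subalgebra_C0 smul amul star K \<longleftrightarrow>
     K \<subseteq> C0 \<and> 0 \<in> K \<and> (\<forall>f\<in>K. \<forall>g\<in>K. f + g \<in> K) \<and>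
     (\<forall>c. \<forall>f\<in>K. \<exists>h\<in>K. \<forall>x. apply_bcontfun h x = smul c (apply_bcontfun f x)) \<and>
     (\<forall>f\<in>K. \<forall>g\<in>K. \<exists>h\<in>K. \<forall>x. apply_bcontfun h x = amul (apply_bcontfun f x) (apply_bcontfun g x)) \<and>
     (\<forall>f\<in>K. \<exists>h\<in>K. \<forall>x. apply_bcontfun h x = star (apply_bcontfun f x))"

end

theory Submission
  imports Defs "HOL-Probability.Discrete_Topology" "HOL-Probability.Probability_Measure"
begin

text \<open>On a compact set \<open>L\<close>, identify \<open>g\<close> with the function \<open>(x, \<phi>) \<mapsto> \<phi> (g x)\<close> on the
  compact space \<open>L \<times> B\<close>, where \<open>B\<close> is the unit ball of the real dual of \<open>E\<close> with the weak-*
  topology. If \<open>f\<close> has positive distance \<open>\<delta>\<close> from the convex set \<open>K\<close> on \<open>L\<close>, Hahn--Banach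
  gives a normalized positive functional, hence a probability measure, for which
  \<open>\<integral> (f - k) \<ge> \<delta>\<close> for all \<open>k \<in> K\<close>. By dominated convergence this inequality is inherited by
  everything in the hull of \<open>K\<close>, so \<open>f\<close> is not in the hull. Thus \<open>f\<close> can be approximated by
  elements of \<open>K\<close> uniformly on every compact set. If the approximants can be taken uniformly bounded,
  averages of a gliding-hump sequence approximate \<open>f\<close> uniformly. In the C*-algebra case boundedness
  is achieved by replacing the self-adjoint parts \<open>a\<close> of the approximants by
  \<open>a (1 + isa)\<^sup>-\<^sup>1\<close> with a small \<open>s > 0\<close>.\<close>

section \<open>Hahn--Banach separation for sublinear functionals\<close>

text \<open>Pairing with functionals turns weak convergence in \<open>E\<close> into pointwise
  convergence of scalar functions, to which dominated convergence applies. That takes a countably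
  additive measure, whereas Hahn--Banach supplies only a linear functional \<open>\<Phi>\<close>;
  hence the construction of a measure from \<open>\<Phi>\<close>. What it has to satisfy is the
  inequality \<open>\<Phi> h \<le> \<integral> h\<close>, because the separation bounds
  \<open>\<Phi>\<close> from below and the integrals then inherit this bound.

  When \<open>K\<close> is an algebra, a function close to \<open>f\<close> on \<open>L\<close> may
  be arbitrarily large elsewhere, while the averaging requires one bound for all \<open>L\<close>.
  The truncation is bounded by \<open>2 / s\<close> whatever \<open>a\<close> is, and
  \<open>s\<close> can be fixed from \<open>f\<close> and the tolerance alone. As \<open>E\<close>
  may have no unit, the truncation is described by the equation \<open>h + isah = a\<close>; as
  \<open>K\<close> need not be closed, \<open>h\<close> is replaced by an iterate close to it,
  formed from \<open>a\<close> by algebra operations. The norm estimates rest on the C*-identity and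
  submultiplicativity.\<close>

definition sublinear :: "('v::real_vector \<Rightarrow> real) \<Rightarrow> bool" where
  "sublinear p \<longleftrightarrow> (\<forall>x y. p (x + y) \<le> p x + p y) \<and> (\<forall>t x. 0 \<le> t \<longrightarrow> p (t *\<^sub>R x) = t * p x)"

lemma sublinearI:
  assumes "\<And>x y. p (x + y) \<le> p x + p y" "p 0 = 0" "\<And>t x. 0 < t \<Longrightarrow> p (t *\<^sub>R x) \<le> t * p x"
  shows "sublinear p"
  unfolding sublinear_def
proof (intro conjI allI impI)
  fix t :: real and x assume "0 \<le> t"
  show "p (t *\<^sub>R x) = t * p x"
  proof (cases "t = 0")
    case True
    then show ?thesis using assms(2) by simp
  next
    case False
    with \<open>0 \<le> t\<close> have t: "0 < t" by simp
    have "p ((1 / t) *\<^sub>R (t *\<^sub>R x)) \<le> (1 / t) * p (t *\<^sub>R x)"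
      using t by (intro assms(3)) simp
    then have "t * p x \<le> p (t *\<^sub>R x)"
      using t by (simp add: field_simps)
    with assms(3)[OF t, of x] show ?thesis by simp
  qed
qed (use assms(1) in auto)

lemma sublinear_add: "sublinear p \<Longrightarrow> p (x + y) \<le> p x + p y"
  and sublinear_scaleR: "sublinear p \<Longrightarrow> 0 \<le> t \<Longrightarrow> p (t *\<^sub>R x) = t * p x"
  by (auto simp: sublinear_def)

lemma sublinear_zero: "sublinear p \<Longrightarrow> p 0 = 0"
  using sublinear_scaleR[of p 0 0] by simp

lemma sublinear_lower: "sublinear p \<Longrightarrow> - p (- x) \<le> p x"
  using sublinear_add[of p x "- x"] sublinear_zero[of p] by simp

text \<open>The infimum is forced: a sublinear \<open>r \<le> p\<close> with
  \<open>r (- d) \<le> - \<delta>\<close> on \<open>D\<close> satisfies \<open>r x \<le> r (x + t d)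
  + t * r (- d) \<le> p (x + t d) - t * \<delta>\<close>, so \<open>q\<close> is the largest such
  \<open>r\<close>. The bound \<open>ge\<close> keeps the infimum finite. Convexity of
  \<open>D\<close> gives subadditivity, since \<open>t d + s e\<close> is \<open>t + s\<close> times
  a point of \<open>D\<close>.\<close>

lemma sublinear_push_down:
  fixes p :: "'v::real_vector \<Rightarrow> real"
  assumes p: "sublinear p" and D: "convex D" "D \<noteq> {}" and ge: "\<And>d. d \<in> D \<Longrightarrow> \<delta> \<le> p d"
  obtains q where "sublinear q" "q \<le> p" "\<And>d. d \<in> D \<Longrightarrow> q (- d) \<le> - \<delta>"
proof -
  define I where "I = {0::real..} \<times> D"
  define F where "F x = (\<lambda>(t, d). p (x + t *\<^sub>R d) - t * \<delta>)" for x
  define q where "q x = (INF i\<in>I. F x i)" for x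
  obtain d0 where d0: "d0 \<in> D" using D by auto
  have I: "I \<noteq> {}" using d0 by (auto simp: I_def)
  have lower: "- p (- x) \<le> F x i" if "i \<in> I" for x i
  proof -
    obtain t d where i: "i = (t, d)" "0 \<le> t" "d \<in> D" using \<open>i \<in> I\<close> by (auto simp: I_def)
    have "t * \<delta> \<le> t * p d" using ge i by (intro mult_left_mono) auto
    also have "\<dots> = p (t *\<^sub>R d)" using sublinear_scaleR[OF p] i by simp
    also have "\<dots> \<le> p (x + t *\<^sub>R d) + p (- x)"
      using sublinear_add[OF p, of "x + t *\<^sub>R d" "- x"] by simp
    finally show ?thesis by (simp add: F_def i)
  qed
  have bdd: "bdd_below (F x ` I)" for x
    using lower by (intro bdd_belowI2)
  have le: "q x \<le> p (x + t *\<^sub>R d) - t * \<delta>" if "0 \<le> t" "d \<in> D" for x t d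
    using cINF_lower[OF bdd, of "(t, d)" x] that by (simp add: q_def I_def F_def)
  have greatest: "c \<le> q x" if "\<And>t d. 0 \<le> t \<Longrightarrow> d \<in> D \<Longrightarrow> c \<le> p (x + t *\<^sub>R d) - t * \<delta>" for c x
    unfolding q_def using I that by (intro cINF_greatest) (auto simp: I_def F_def)
  have q_le: "q x \<le> p x" for x using le[of 0 d0 x] d0 by simp
  have "sublinear q"
  proof (rule sublinearI)
    fix x y
    have *: "q (x + y) \<le> (p (x + t *\<^sub>R d) - t * \<delta>) + (p (y + s *\<^sub>R e) - s * \<delta>)"
      if "0 \<le> t" "d \<in> D" "0 \<le> s" "e \<in> D" for t d s e
    proof (cases "t + s = 0")
      case True
      then have "t = 0" "s = 0" using that by auto
      then show ?thesis using q_le[of "x + y"] sublinear_add[OF p, of x y] by simp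
    next
      case False
      then have ts: "0 < t + s" using that by auto
      define m where "m = (t / (t + s)) *\<^sub>R d + (s / (t + s)) *\<^sub>R e"
      have "m \<in> D" unfolding m_def using that ts
        by (intro convexD[OF D(1)]) (auto simp: add_divide_distrib[symmetric])
      have m: "(t + s) *\<^sub>R m = t *\<^sub>R d + s *\<^sub>R e"
        using ts by (simp add: m_def scaleR_add_right)
      have "q (x + y) \<le> p ((x + y) + (t + s) *\<^sub>R m) - (t + s) * \<delta>"
        using le[of "t + s" m] ts \<open>m \<in> D\<close> by simp
      also have "(x + y) + (t + s) *\<^sub>R m = (x + t *\<^sub>R d) + (y + s *\<^sub>R e)"
        unfolding m by (simp add: algebra_simps)
      also have "p \<dots> \<le> p (x + t *\<^sub>R d) + p (y + s *\<^sub>R e)" by (rule sublinear_add[OF p])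
      finally show ?thesis by (simp add: algebra_simps)
    qed
    have "q (x + y) - (p (x + t *\<^sub>R d) - t * \<delta>) \<le> q y" if "0 \<le> t" "d \<in> D" for t d
      using *[OF that] by (intro greatest) (simp add: algebra_simps)
    then have "q (x + y) - q y \<le> q x"
      by (intro greatest) (simp add: algebra_simps)
    then show "q (x + y) \<le> q x + q y" by simp
  next
    have "0 \<le> q 0"
      using lower[of _ 0] sublinear_zero[OF p] I unfolding q_def by (intro cINF_greatest) auto
    then show "q 0 = 0" using q_le[of 0] sublinear_zero[OF p] by simp
  next
    fix r :: real and x assume r: "0 < r"
    have "(1 / r) * q (r *\<^sub>R x) \<le> q x"
    proof (rule greatest)
      fix t d assume td: "0 \<le> (t::real)" "d \<in> D"
      have "q (r *\<^sub>R x) \<le> p (r *\<^sub>R x + (r * t) *\<^sub>R d) - r * t * \<delta>"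
        using td r by (intro le) auto
      also have "r *\<^sub>R x + (r * t) *\<^sub>R d = r *\<^sub>R (x + t *\<^sub>R d)" by (simp add: scaleR_add_right)
      also have "p \<dots> = r * p (x + t *\<^sub>R d)" using r by (intro sublinear_scaleR[OF p]) simp
      finally show "(1 / r) * q (r *\<^sub>R x) \<le> p (x + t *\<^sub>R d) - t * \<delta>"
        using r by (simp add: field_simps)
    qed
    then show "q (r *\<^sub>R x) \<le> r * q x" using r by (simp add: field_simps)
  qed
  moreover have "q \<le> p" using q_le by (auto simp: le_fun_def)
  moreover have "q (- d) \<le> - \<delta>" if "d \<in> D" for d
    using le[of 1 d "- d"] that sublinear_zero[OF p] by simp
  ultimately show thesis by (rule that)
qed

text \<open>Zorn's lemma applies because the infimum \<open>u\<close> of a chain is again sublinear: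
  to compare \<open>u (x + y)\<close> with \<open>a x + b y\<close> for two members of the chain,
  the smaller one serves at both points. The value \<open>- p (- x)\<close> bounds all members from
  below.\<close>

lemma minimal_sublinear:
  fixes p :: "'v::real_vector \<Rightarrow> real"
  assumes p: "sublinear p"
  obtains m where "sublinear m" "m \<le> p" "\<And>q. sublinear q \<Longrightarrow> q \<le> m \<Longrightarrow> q = m"
proof -
  define A where "A = {q. sublinear q \<and> q \<le> p}"
  have "\<exists>m\<in>A. \<forall>a\<in>A. m \<ge> a \<longrightarrow> a = m"
  proof (rule predicate_Zorn)
    show "partial_order_on A (relation_of (\<ge>) A)"
      by (rule partial_order_on_relation_ofI) auto
  next
    fix C assume C: "C \<in> Chains (relation_of (\<ge>) A)"
    have CA: "C \<subseteq> A" using C by (auto simp: Chains_def relation_of_def)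
    have chain: "a \<le> b \<or> b \<le> a" if "a \<in> C" "b \<in> C" for a b
      using C that by (auto simp: Chains_def relation_of_def)
    show "\<exists>u\<in>A. \<forall>a\<in>C. a \<ge> u"
    proof (cases "C = {}")
      case True
      then show ?thesis using p by (auto simp: A_def)
    next
      case False
      define u where "u x = (INF a\<in>C. a x)" for x
      have sub: "sublinear a" if "a \<in> C" for a using that CA by (auto simp: A_def)
      have "- p (- x) \<le> a x" if "a \<in> C" for a x
      proof -
        have "a (- x) \<le> p (- x)" using that CA by (auto simp: A_def le_fun_def)
        then show ?thesis using sublinear_lower[OF sub[OF that], of x] by simp
      qed
      then have bdd: "bdd_below ((\<lambda>a. a x) ` C)" for x by (intro bdd_belowI2)
      have le: "u x \<le> a x" if "a \<in> C" for a x
        unfolding u_def using that by (intro cINF_lower[OF bdd])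
      have greatest: "c \<le> u x" if "\<And>a. a \<in> C \<Longrightarrow> c \<le> a x" for c x
        unfolding u_def using False that by (intro cINF_greatest) auto
      have "sublinear u"
      proof (rule sublinearI)
        fix x y
        have *: "u (x + y) \<le> a x + b y" if "a \<in> C" "b \<in> C" for a b
          using chain[OF that]
        proof
          assume "a \<le> b"
          have "u (x + y) \<le> a (x + y)" using le that by simp
          also have "\<dots> \<le> a x + a y" using sublinear_add sub that by blast
          also have "a y \<le> b y" using \<open>a \<le> b\<close> by (simp add: le_fun_def)
          finally show ?thesis by simp
        next
          assume "b \<le> a"
          have "u (x + y) \<le> b (x + y)" using le that by simp
          also have "\<dots> \<le> b x + b y" using sublinear_add sub that by blast
          also have "b x \<le> a x" using \<open>b \<le> a\<close> by (simp add: le_fun_def)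
          finally show ?thesis by simp
        qed
        have "u (x + y) - a x \<le> u y" if "a \<in> C" for a
          using *[OF that] by (intro greatest) (simp add: algebra_simps)
        then have "u (x + y) - u y \<le> u x" by (intro greatest) (simp add: algebra_simps)
        then show "u (x + y) \<le> u x + u y" by simp
      next
        have "(\<lambda>a. a 0) ` C = {0}" using False sublinear_zero[OF sub] by force
        then show "u 0 = 0" by (simp add: u_def)
      next
        fix t :: real and x assume t: "0 < t"
        have "(1 / t) * u (t *\<^sub>R x) \<le> u x"
        proof (rule greatest)
          fix a assume a: "a \<in> C"
          have "u (t *\<^sub>R x) \<le> a (t *\<^sub>R x)" using le a by simp
          also have "\<dots> = t * a x" using sublinear_scaleR[OF sub[OF a]] t by simp
          finally show "(1 / t) * u (t *\<^sub>R x) \<le> a x" using t by (simp add: field_simps)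
        qed
        then show "u (t *\<^sub>R x) \<le> t * u x" using t by (simp add: field_simps)
      qed
      moreover have "u \<le> p"
      proof -
        obtain a where "a \<in> C" using False by auto
        then have "u \<le> a" "a \<le> p" using le CA by (auto simp: le_fun_def A_def)
        then show ?thesis by simp
      qed
      ultimately have "u \<in> A" by (simp add: A_def)
      then show ?thesis using le by (auto simp: le_fun_def)
    qed
  qed
  then obtain m where "m \<in> A" "\<And>a. a \<in> A \<Longrightarrow> a \<le> m \<Longrightarrow> a = m" by auto
  then show thesis by (intro that[of m]) (auto simp: A_def)
qed

text \<open>A minimal sublinear functional is linear: pushing \<open>m\<close> down along
  \<open>{x}\<close> at level \<open>m x\<close> cannot change it, so
  \<open>m (- x) \<le> - m x\<close>, and an odd subadditive function is additive. The earlier push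
  along \<open>D\<close> has already built the separation into everything below
  \<open>q\<close>.\<close>

lemma hahn_banach_separation:
  fixes p :: "'v::real_vector \<Rightarrow> real"
  assumes p: "sublinear p" and D: "convex D" "D \<noteq> {}" and ge: "\<And>d. d \<in> D \<Longrightarrow> \<delta> \<le> p d"
  obtains \<phi> where "linear \<phi>" "\<And>x. \<phi> x \<le> p x" "\<And>d. d \<in> D \<Longrightarrow> \<delta> \<le> \<phi> d"
proof -
  obtain q where q: "sublinear q" "q \<le> p" "\<And>d. d \<in> D \<Longrightarrow> q (- d) \<le> - \<delta>"
    using sublinear_push_down[OF p D ge] by blast
  obtain m where m: "sublinear m" "m \<le> q" and min: "\<And>r. sublinear r \<Longrightarrow> r \<le> m \<Longrightarrow> r = m"
    using minimal_sublinear[OF q(1)] by blast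
  have odd: "m (- x) = - m x" for x
  proof -
    obtain r where r: "sublinear r" "r \<le> m" "\<And>d. d \<in> {x} \<Longrightarrow> r (- d) \<le> - m x"
      using sublinear_push_down[OF m(1), of "{x}" "m x"] by auto
    then have "m (- x) \<le> - m x" using min by blast
    then show ?thesis using sublinear_lower[OF m(1), of x] by simp
  qed
  have add: "m (x + y) = m x + m y" for x y
    using sublinear_add[OF m(1), of x y] sublinear_add[OF m(1), of "- x" "- y"] odd[of x] odd[of y]
      odd[of "x + y"] by (simp add: add.commute)
  have "linear m"
  proof (rule linearI)
    fix t :: real and x
    show "m (t *\<^sub>R x) = t *\<^sub>R m x"
      using sublinear_scaleR[OF m(1), of t x] sublinear_scaleR[OF m(1), of "- t" x] odd[of "t *\<^sub>R x"]
      by (cases "0 \<le> t") auto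
  qed (rule add)
  moreover have "m x \<le> p x" for x using m(2) q(2) by (auto simp: le_fun_def intro: order_trans)
  moreover have "\<delta> \<le> m d" if "d \<in> D" for d
  proof -
    have "m (- d) \<le> q (- d)" using m(2) by (simp add: le_fun_def)
    then show ?thesis using q(3)[OF that] odd[of d] by simp
  qed
  ultimately show thesis by (rule that)
qed

lemma sublinear_norm: "sublinear (norm :: 'v::real_normed_vector \<Rightarrow> real)"
  by (simp add: sublinear_def norm_triangle_ineq)

lemma norming_functional:
  fixes x :: "'v::real_normed_vector"
  obtains \<phi> :: "'v \<Rightarrow> real" where "linear \<phi>" "\<And>v. \<bar>\<phi> v\<bar> \<le> norm v" "norm x \<le> \<phi> x"
proof -
  obtain \<phi> :: "'v \<Rightarrow> real" where \<phi>: "linear \<phi>" "\<And>v. \<phi> v \<le> norm v" "norm x \<le> \<phi> x"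
    using hahn_banach_separation[OF sublinear_norm, of "{x}" "norm x"] by auto
  have "\<bar>\<phi> v\<bar> \<le> norm v" for v
    using \<phi>(2)[of v] \<phi>(2)[of "- v"] linear_neg[OF \<phi>(1), of v] by simp
  with \<phi> show thesis by (intro that)
qed

section \<open>Positive functionals and measures on compact spaces\<close>

text \<open>Functions are total but constrained only on \<open>X\<close>; by \<open>mono\<close>,
  the value of \<open>\<Phi>\<close> at a function continuous on \<open>X\<close> depends only on
  its restriction to \<open>X\<close>.\<close>

locale positive_functional =
  fixes X :: "'x::topological_space set" and \<Phi> :: "('x \<Rightarrow> real) \<Rightarrow> real"
  assumes compact_X: "compact X"
    and add: "continuous_on X f \<Longrightarrow> continuous_on X g \<Longrightarrow> \<Phi> (\<lambda>x. f x + g x) = \<Phi> f + \<Phi> g"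
    and scale: "continuous_on X f \<Longrightarrow> \<Phi> (\<lambda>x. c * f x) = c * \<Phi> f"
    and mono: "continuous_on X f \<Longrightarrow> continuous_on X g \<Longrightarrow> (\<And>x. x \<in> X \<Longrightarrow> f x \<le> g x) \<Longrightarrow> \<Phi> f \<le> \<Phi> g"
    and one: "\<Phi> (\<lambda>_. 1) = 1"

text \<open>Hahn--Banach is applied in the space of all bounded functions on the discrete copy of the
  underlying type, where continuous functions on \<open>X\<close> are extended by zero.\<close>

lemma separating_positive_functional:
  fixes X :: "'x::topological_space set" and D :: "('x \<Rightarrow> real) set"
  assumes X: "compact X" and D: "D \<noteq> {}" and cont: "\<And>d. d \<in> D \<Longrightarrow> continuous_on X d"
    and conv: "\<And>d e t. d \<in> D \<Longrightarrow> e \<in> D \<Longrightarrow> 0 \<le> t \<Longrightarrow> t \<le> 1 \<Longrightarrow>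
      \<exists>c\<in>D. \<forall>x\<in>X. c x = (1 - t) * d x + t * e x"
    and ge: "\<And>d. d \<in> D \<Longrightarrow> \<exists>x\<in>X. \<delta> \<le> d x"
  obtains \<Phi> where "positive_functional X \<Phi>" "\<And>d. d \<in> D \<Longrightarrow> \<delta> \<le> \<Phi> d"
proof -
  define emb :: "('x \<Rightarrow> real) \<Rightarrow> 'x discrete \<Rightarrow>\<^sub>C real"
    where "emb f = Bcontfun (\<lambda>y. if of_discrete y \<in> X then f (of_discrete y) else 0)" for f
  define N :: "('x discrete \<Rightarrow>\<^sub>C real) \<Rightarrow> real"
    where "N b = (SUP x\<in>X. apply_bcontfun b (discrete x))" for b
  have X0: "X \<noteq> {}" using D ge by blast
  have emb: "apply_bcontfun (emb f) y = (if of_discrete y \<in> X then f (of_discrete y) else 0)"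
    if "continuous_on X f" for f y
  proof -
    have "bounded (f ` X)"
      using X that by (intro compact_imp_bounded compact_continuous_image)
    then obtain B where B: "\<And>x. x \<in> X \<Longrightarrow> norm (f x) \<le> B" by (auto simp: bounded_iff)
    have "(\<lambda>y. if of_discrete y \<in> X then f (of_discrete y) else 0) \<in> bcontfun"
    proof (rule bcontfun_normI)
      show "norm (if of_discrete y \<in> X then f (of_discrete y) else 0) \<le> \<bar>B\<bar>" for y
        using B[of "of_discrete y"] by auto
    qed (auto simp: continuous_on_open_vimage open_discrete)
    then show ?thesis by (simp add: emb_def Bcontfun_inverse)
  qed
  have emb_eqI: "emb f = b"
    if "continuous_on X f" "\<And>x. x \<in> X \<Longrightarrow> apply_bcontfun b (discrete x) = f x"
      "\<And>y. of_discrete y \<notin> X \<Longrightarrow> apply_bcontfun b y = 0" for f b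
    using that by (intro bcontfun_eqI) (auto simp: emb, metis of_discrete_inverse)
  have bdd: "bdd_above ((\<lambda>x. apply_bcontfun b (discrete x)) ` X)" for b :: "'x discrete \<Rightarrow>\<^sub>C real"
  proof (rule bounded_imp_bdd_above)
    show "bounded ((\<lambda>x. apply_bcontfun b (discrete x)) ` X)"
      by (rule bounded_subset[OF bounded_apply_bcontfun[of b]]) auto
  qed
  have N_upper: "apply_bcontfun b (discrete x) \<le> N b" if "x \<in> X" for b x
    unfolding N_def using that by (intro cSUP_upper bdd)
  have N_least: "N b \<le> c" if "\<And>x. x \<in> X \<Longrightarrow> apply_bcontfun b (discrete x) \<le> c" for b c
    unfolding N_def using X0 that by (intro cSUP_least)
  have "sublinear N"
  proof (rule sublinearI)
    show "N (a + b) \<le> N a + N b" for a b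
      using N_upper[of _ a] N_upper[of _ b] by (intro N_least) (auto intro: add_mono)
    show "N 0 = 0" using X0 by (simp add: N_def)
    show "N (t *\<^sub>R b) \<le> t * N b" if "0 < t" for t b
      using N_upper[of _ b] that by (intro N_least) (auto intro: mult_left_mono)
  qed
  moreover have "convex (emb ` D)"
    unfolding convex_alt
  proof (intro ballI allI impI, elim imageE)
    fix t :: real and b b' d e assume de: "b = emb d" "d \<in> D" "b' = emb e" "e \<in> D" "0 \<le> t \<and> t \<le> 1"
    then obtain c where c: "c \<in> D" "\<forall>x\<in>X. c x = (1 - t) * d x + t * e x" using conv by blast
    have "emb c = (1 - t) *\<^sub>R b + t *\<^sub>R b'"
      using c(2) de cont by (intro emb_eqI cont[OF c(1)]) (auto simp: emb discrete_inverse)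
    then show "(1 - t) *\<^sub>R b + t *\<^sub>R b' \<in> emb ` D" using c by force
  qed
  moreover have "\<delta> \<le> N b" if b: "b \<in> emb ` D" for b
  proof -
    obtain d where d: "d \<in> D" "b = emb d" using b by auto
    obtain x where x: "x \<in> X" "\<delta> \<le> d x" using ge[OF d(1)] by auto
    have "apply_bcontfun b (discrete x) = d x"
      using cont d x by (simp add: emb discrete_inverse)
    then show ?thesis using N_upper[OF x(1), of b] x(2) by simp
  qed
  ultimately obtain \<psi> where \<psi>: "linear \<psi>" "\<And>b. \<psi> b \<le> N b" "\<And>b. b \<in> emb ` D \<Longrightarrow> \<delta> \<le> \<psi> b"
    using hahn_banach_separation[of N "emb ` D" \<delta>] D by blast
  define \<Phi> where "\<Phi> f = \<psi> (emb f)" for f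
  have add: "\<Phi> (\<lambda>x. f x + g x) = \<Phi> f + \<Phi> g" if "continuous_on X f" "continuous_on X g" for f g
  proof -
    have "emb (\<lambda>x. f x + g x) = emb f + emb g"
      using that by (intro emb_eqI) (auto simp: emb discrete_inverse intro: continuous_intros)
    then show ?thesis by (simp add: \<Phi>_def linear_add[OF \<psi>(1)])
  qed
  have scale: "\<Phi> (\<lambda>x. c * f x) = c * \<Phi> f" if "continuous_on X f" for c f
  proof -
    have "emb (\<lambda>x. c * f x) = c *\<^sub>R emb f"
      using that by (intro emb_eqI) (auto simp: emb discrete_inverse intro: continuous_intros)
    then show ?thesis by (simp add: \<Phi>_def linear_scale[OF \<psi>(1)])
  qed
  \<comment> \<open>Domination by the one-sided supremum \<open>N\<close>, rather than by a norm,
    carries both positivity (with \<open>c = 0\<close>) and normalization (with the constants 1 and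
    -1).\<close>
  have le: "\<Phi> f \<le> c" if "continuous_on X f" "\<And>x. x \<in> X \<Longrightarrow> f x \<le> c" for f c
  proof -
    have "\<Phi> f \<le> N (emb f)" by (simp add: \<Phi>_def \<psi>(2))
    also have "\<dots> \<le> c" using that by (intro N_least) (auto simp: emb discrete_inverse)
    finally show ?thesis .
  qed
  have "positive_functional X \<Phi>"
  proof
    fix f g :: "'x \<Rightarrow> real" assume fg: "continuous_on X f" "continuous_on X g" "\<And>x. x \<in> X \<Longrightarrow> f x \<le> g x"
    have "\<Phi> (\<lambda>x. f x + (- 1) * g x) \<le> 0"
      using fg by (intro le continuous_intros) auto
    also have "\<Phi> (\<lambda>x. f x + (- 1) * g x) = \<Phi> f + \<Phi> (\<lambda>x. (- 1) * g x)"
      using fg by (intro add continuous_intros) auto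
    also have "\<Phi> (\<lambda>x. (- 1) * g x) = - 1 * \<Phi> g" using fg by (intro scale)
    finally show "\<Phi> f \<le> \<Phi> g" by simp
  next
    have "\<Phi> (\<lambda>_. (- 1) * 1) \<le> - 1" by (rule le) auto
    then have "1 \<le> \<Phi> (\<lambda>_. 1)" by (subst (asm) scale) auto
    moreover have "\<Phi> (\<lambda>_. 1) \<le> 1" by (rule le) auto
    ultimately show "\<Phi> (\<lambda>_. 1) = 1" by simp
  qed (use X add scale in auto)
  moreover have "\<delta> \<le> \<Phi> d" if "d \<in> D" for d
    unfolding \<Phi>_def using that by (intro \<psi>(3)) auto
  ultimately show thesis by (rule that)
qed

context positive_functional
begin

lemma nonneg: "continuous_on X f \<Longrightarrow> (\<And>x. x \<in> X \<Longrightarrow> 0 \<le> f x) \<Longrightarrow> 0 \<le> \<Phi> f"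
  using mono[of "\<lambda>_. 0" f] scale[of f 0] by simp

lemma cong: "continuous_on X f \<Longrightarrow> continuous_on X g \<Longrightarrow> (\<And>x. x \<in> X \<Longrightarrow> f x = g x) \<Longrightarrow> \<Phi> f = \<Phi> g"
  by (intro antisym mono) auto

lemma const: "\<Phi> (\<lambda>_. c) = c"
  using scale[of "\<lambda>_. 1" c] one by simp

lemma sum: "(\<And>i. i < n \<Longrightarrow> continuous_on X (f i)) \<Longrightarrow> \<Phi> (\<lambda>x. \<Sum>i<n. f i x) = (\<Sum>i<n. \<Phi> (f i))"
  for n :: nat
proof (induction n)
  case 0
  then show ?case using const[of 0] by simp
next
  case (Suc n)
  have "\<Phi> (\<lambda>x. (\<Sum>i<n. f i x) + f n x) = \<Phi> (\<lambda>x. \<Sum>i<n. f i x) + \<Phi> (f n)"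
    using Suc.prems by (intro add continuous_on_sum) auto
  then show ?case using Suc by simp
qed

text \<open>Compactness makes up for \<open>\<Phi>\<close> being only finitely additive: the open
  sets where the m-th partial sum exceeds \<open>u - e\<close> increase with m and cover
  \<open>X\<close>, so a single partial sum does so on all of \<open>X\<close>.\<close>

lemma dini:
  fixes h :: "nat \<Rightarrow> 'x \<Rightarrow> real"
  assumes u: "continuous_on X u" and h: "\<And>n. continuous_on X (h n)" "\<And>n x. x \<in> X \<Longrightarrow> 0 \<le> h n x"
    and le: "\<And>x. x \<in> X \<Longrightarrow> ennreal (u x) \<le> (\<Sum>n. ennreal (h n x))"
  shows "ennreal (\<Phi> u) \<le> (\<Sum>n. ennreal (\<Phi> (h n)))"
proof (rule ennreal_le_epsilon)
  fix e :: real assume e: "0 < e"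
  define s where "s m x = (\<Sum>n<m. h n x)" for m x
  have s: "continuous_on X (s m)" for m
    unfolding s_def by (intro continuous_on_sum h)
  have s_mono: "s m x \<le> s n x" if "m \<le> n" "x \<in> X" for m n x
    unfolding s_def using that h by (intro sum_mono2) auto
  have "\<exists>T. open T \<and> T \<inter> X = (\<lambda>x. s m x - u x) -` {- e<..} \<inter> X" for m
  proof -
    have "continuous_on X (\<lambda>x. s m x - u x)" by (intro continuous_intros s u)
    then show ?thesis
      unfolding continuous_on_open_invariant by (elim allE[of _ "{- e<..}"] impE) simp
  qed
  then obtain T where T: "\<And>m. open (T m)" "\<And>m. T m \<inter> X = (\<lambda>x. s m x - u x) -` {- e<..} \<inter> X"
    by metis
  have "X \<subseteq> (\<Union>m. T m)"
  proof
    fix x assume x: "x \<in> X"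
    have "\<exists>m. u x - e < s m x"
    proof (rule ccontr)
      assume "\<not> ?thesis"
      then have *: "s m x \<le> u x - e" for m by (simp add: not_less)
      have "0 \<le> u x - e" using *[of 0] by (simp add: s_def)
      have "(\<Sum>n. ennreal (h n x)) \<le> ennreal (u x - e)"
      proof (rule suminf_le_const)
        show "(\<Sum>n<m. ennreal (h n x)) \<le> ennreal (u x - e)" for m
          using *[of m] h(2)[OF x] by (simp add: s_def sum_ennreal ennreal_leI)
      qed auto
      with le[OF x] have "ennreal (u x) \<le> ennreal (u x - e)" by (rule order_trans)
      then show False using e \<open>0 \<le> u x - e\<close> by simp
    qed
    then obtain m where "u x - e < s m x" ..
    then have "x \<in> T m \<inter> X" unfolding T(2) using x by auto
    then show "x \<in> (\<Union>m. T m)" by blast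
  qed
  with compact_X T(1) obtain C where C: "finite C" "X \<subseteq> (\<Union>m\<in>C. T m)"
    using compactE_image[of X UNIV T] by auto
  define m where "m = Max (insert 0 C)"
  have "u x - e \<le> s m x" if x: "x \<in> X" for x
  proof -
    obtain k where k: "k \<in> C" "x \<in> T k" using C x by auto
    then have "x \<in> T k \<inter> X" using x by simp
    then have "u x - e < s k x" unfolding T(2) by auto
    also have "s k x \<le> s m x" using s_mono[of k m x] C k x by (simp add: m_def)
    finally show ?thesis by simp
  qed
  then have "\<Phi> u \<le> \<Phi> (\<lambda>x. s m x + e)"
    by (intro mono continuous_intros u s) (simp add: algebra_simps)
  also have "\<dots> = \<Phi> (s m) + e" using s by (subst add) (auto simp: const)
  also have "\<Phi> (s m) = (\<Sum>n<m. \<Phi> (h n))" unfolding s_def using h by (intro sum)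
  finally have "ennreal (\<Phi> u) \<le> ennreal ((\<Sum>n<m. \<Phi> (h n)) + e)" by (rule ennreal_leI)
  also have "\<dots> = (\<Sum>n<m. ennreal (\<Phi> (h n))) + ennreal e"
    using e h by (subst ennreal_plus) (auto simp: sum_nonneg nonneg sum_ennreal)
  also have "(\<Sum>n<m. ennreal (\<Phi> (h n))) \<le> (\<Sum>n. ennreal (\<Phi> (h n)))"
    by (rule sum_le_suminf) auto
  finally show "ennreal (\<Phi> u) \<le> (\<Sum>n. ennreal (\<Phi> (h n))) + ennreal e" by simp
qed

section \<open>The outer measure of a positive functional\<close>

definition covers :: "'x set \<Rightarrow> (nat \<Rightarrow> 'x \<Rightarrow> real) set" where
  "covers S = {h. (\<forall>n. continuous_on X (h n) \<and> (\<forall>x\<in>X. 0 \<le> h n x)) \<and>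
     (\<forall>x\<in>S. 1 \<le> (\<Sum>n. ennreal (h n x)))}"

text \<open>As in Daniell's construction, sets are covered by series of nonnegative continuous
  functions instead of open sets, so that only values of \<open>\<Phi>\<close> on its natural domain
  enter.\<close>

definition outer :: "'x set \<Rightarrow> ennreal" where
  "outer S = (INF h\<in>covers S. \<Sum>n. ennreal (\<Phi> (h n)))"

lemma outer_le: "h \<in> covers S \<Longrightarrow> outer S \<le> (\<Sum>n. ennreal (\<Phi> (h n)))"
  unfolding outer_def by (rule INF_lower)

text \<open>Dini's argument prevents \<open>outer\<close> from collapsing; every later lower bound
  on the measure comes from here.\<close>

lemma functional_le_outer:
  assumes "continuous_on X u" "\<And>x. x \<in> X \<Longrightarrow> u x \<le> indicator S x"
  shows "ennreal (\<Phi> u) \<le> outer S"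
  unfolding outer_def
proof (rule INF_greatest)
  fix h assume h: "h \<in> covers S"
  have "ennreal (u x) \<le> (\<Sum>n. ennreal (h n x))" if "x \<in> X" for x
  proof (cases "x \<in> S")
    case True
    have "ennreal (u x) \<le> ennreal 1" using assms(2)[OF that] True by (intro ennreal_leI) simp
    also have "\<dots> \<le> (\<Sum>n. ennreal (h n x))" using h True by (simp add: covers_def)
    finally show ?thesis .
  next
    case False
    then show ?thesis using assms(2)[OF that] by (simp add: ennreal_neg)
  qed
  then show "ennreal (\<Phi> u) \<le> (\<Sum>n. ennreal (\<Phi> (h n)))"
    using h assms(1) by (intro dini) (auto simp: covers_def)
qed

lemma outer_measure_space_outer: "outer_measure_space (Pow X) outer"
  unfolding outer_measure_space_def
proof (intro conjI)
  have "outer {} \<le> (\<Sum>n. ennreal (\<Phi> (\<lambda>_. 0)))"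
    by (rule outer_le) (simp add: covers_def)
  then show "positive (Pow X) outer" by (simp add: positive_def const)
  show "increasing (Pow X) outer"
    unfolding increasing_def outer_def
  proof (intro ballI impI INF_superset_mono)
    show "covers B \<subseteq> covers A" if "A \<subseteq> B" for A B using that by (auto simp: covers_def)
  qed simp
  show "countably_subadditive (Pow X) outer"
    unfolding countably_subadditive_def
  proof (intro allI impI)
    fix A :: "nat \<Rightarrow> 'x set"
    show "outer (\<Union>i. A i) \<le> (\<Sum>n. outer (A n))"
    proof (rule ennreal_le_epsilon)
      fix e :: real assume e: "0 < e" "(\<Sum>n. outer (A n)) < top"
      then have "outer (A n) < outer (A n) + e * (1/2) ^ Suc n" for n
        by (auto simp add: less_top dest!: ennreal_suminf_lessD)
      then have "\<exists>h\<in>covers (A n). (\<Sum>k. ennreal (\<Phi> (h k))) < outer (A n) + e * (1/2) ^ Suc n" for n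
        by (subst (asm) outer_def) (simp add: INF_less_iff)
      then obtain h where h: "\<And>n. h n \<in> covers (A n)"
        and le: "\<And>n. (\<Sum>k. ennreal (\<Phi> (h n k))) \<le> outer (A n) + e * (1/2) ^ Suc n"
        by (metis less_imp_le)
      define g where "g i = (case prod_decode i of (n, k) \<Rightarrow> h n k)" for i
      have "g \<in> covers (\<Union>i. A i)"
      proof -
        have "1 \<le> (\<Sum>i. ennreal (g i x))" if "x \<in> A n" for x n
        proof -
          have "1 \<le> (\<Sum>k. ennreal (h n k x))" using h[of n] that by (simp add: covers_def)
          also have "\<dots> = (\<Sum>j\<in>{n}. \<Sum>k. ennreal (h j k x))" by simp
          also have "\<dots> \<le> (\<Sum>n. \<Sum>k. ennreal (h n k x))" by (rule sum_le_suminf) auto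
          also have "\<dots> = (\<Sum>i. case prod_decode i of (n, k) \<Rightarrow> ennreal (h n k x))"
            by (rule suminf_ennreal_2dimen[symmetric]) simp
          finally show ?thesis by (simp add: g_def split_def)
        qed
        then show ?thesis using h by (auto simp: covers_def g_def split: prod.split)
      qed
      then have "outer (\<Union>i. A i) \<le> (\<Sum>i. ennreal (\<Phi> (g i)))" by (rule outer_le)
      also have "\<dots> = (\<Sum>i. case prod_decode i of (n, k) \<Rightarrow> ennreal (\<Phi> (h n k)))"
        by (simp add: g_def split_def)
      also have "\<dots> = (\<Sum>n. \<Sum>k. ennreal (\<Phi> (h n k)))"
        by (rule suminf_ennreal_2dimen) simp
      also have "\<dots> \<le> (\<Sum>n. outer (A n) + e * (1/2) ^ Suc n)"
        by (intro suminf_le le) auto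
      also have "\<dots> = (\<Sum>n. outer (A n)) + (\<Sum>n. ennreal e * ennreal ((1/2) ^ Suc n))"
        using e(1) by (subst suminf_add[symmetric])
          (auto simp del: ennreal_suminf_cmult simp add: ennreal_mult[symmetric])
      also have "\<dots> = (\<Sum>n. outer (A n)) + e"
        unfolding ennreal_suminf_cmult
        by (subst suminf_ennreal_eq[OF zero_le_power power_half_series]) auto
      finally show "outer (\<Union>i. A i) \<le> (\<Sum>n. outer (A n)) + e" .
    qed
  qed
qed

text \<open>The indicator of \<open>{g > 0}\<close> is the increasing limit of \<open>u\<^sub>m = min 1 (m g)\<close>. Multiplying a
  cover of \<open>S\<close> by the increments of \<open>u\<close> gives a cover of \<open>S \<inter> {g > 0}\<close>, multiplying it by
  \<open>1 - u\<^sub>m\<close> gives a cover of the remainder of \<open>S\<close>.\<close>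

lemma outer_split:
  fixes g :: "'x \<Rightarrow> real"
  assumes g: "continuous_on X g" "\<And>x. x \<in> X \<Longrightarrow> 0 \<le> g x" and S: "S \<subseteq> X"
  shows "outer (S \<inter> {x\<in>X. 0 < g x}) + outer (S - {x\<in>X. 0 < g x}) \<le> outer S"
proof -
  define T where "T = {x\<in>X. 0 < g x}"
  define u where "u m x = min 1 (real m * g x)" for m x
  define v where "v m x = u (Suc m) x - u m x" for m x
  have u: "continuous_on X (u m)" for m
    unfolding u_def by (intro continuous_intros g)
  have v: "continuous_on X (v m)" for m
    unfolding v_def by (intro continuous_intros u)
  have u_range: "0 \<le> u m x" "u m x \<le> 1" and v_nonneg: "0 \<le> v m x" if "x \<in> X" for m x
    using g(2)[OF that] by (auto simp: u_def v_def algebra_simps min_def)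
  have v_sums: "(\<lambda>m. v m x) sums 1" if x: "x \<in> T" for x
  proof -
    obtain N :: nat where N: "1 / g x < real N" using reals_Archimedean2 by blast
    have "u m x = 1" if "N \<le> m" for m
    proof -
      have "1 < real N * g x" using N x by (simp add: T_def field_simps)
      also have "\<dots> \<le> real m * g x" using that x by (intro mult_right_mono) (auto simp: T_def)
      finally show ?thesis by (simp add: u_def)
    qed
    then have "(\<lambda>m. u m x) \<longlonglongrightarrow> 1"
      by (intro tendsto_eventually eventually_sequentiallyI[of N]) auto
    from telescope_sums[OF this] show ?thesis by (simp add: v_def u_def)
  qed
  have "outer (S \<inter> T) + outer (S - T) \<le> (\<Sum>n. ennreal (\<Phi> (h n)))" if h: "h \<in> covers S" for h
  proof -
    have hc: "continuous_on X (h n)" and h0: "x \<in> X \<Longrightarrow> 0 \<le> h n x"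
      and h1: "x \<in> S \<Longrightarrow> 1 \<le> (\<Sum>n. ennreal (h n x))" for n x
      using h by (auto simp: covers_def)
    define b where "b k = (\<Sum>n. ennreal (\<Phi> (\<lambda>x. h n x * v k x)))" for k
    define r where "r m = (\<Sum>n. ennreal (\<Phi> (\<lambda>x. h n x * (1 - u m x))))" for m
    have "outer (S - T) \<le> r m" for m
      unfolding r_def
    proof (rule outer_le)
      have "u m x = 0" if "x \<in> S - T" for x
        using that S g(2)[of x] by (auto simp: T_def u_def)
      then show "(\<lambda>n x. h n x * (1 - u m x)) \<in> covers (S - T)"
        using hc h0 h1 u u_range by (auto simp: covers_def intro!: continuous_intros mult_nonneg_nonneg)
    qed
    \<comment> \<open>Since \<open>v m + (1 - u (Suc m)) = 1 - u m\<close> and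
      \<open>u 0 = 0\<close>, moving one increment from the remainder into the sum leaves the total
      unchanged.\<close>
    moreover have "(\<Sum>k<m. b k) + r m = (\<Sum>n. ennreal (\<Phi> (h n)))" for m
    proof (induction m)
      case 0
      then show ?case by (simp add: r_def u_def)
    next
      case (Suc m)
      have "ennreal (\<Phi> (\<lambda>x. h n x * v m x)) + ennreal (\<Phi> (\<lambda>x. h n x * (1 - u (Suc m) x)))
          = ennreal (\<Phi> (\<lambda>x. h n x * (1 - u m x)))" for n
      proof -
        have "\<Phi> (\<lambda>x. h n x * (1 - u m x)) = \<Phi> (\<lambda>x. h n x * v m x + h n x * (1 - u (Suc m) x))"
          by (intro cong continuous_intros hc u v) (simp add: v_def algebra_simps)
        also have "\<dots> = \<Phi> (\<lambda>x. h n x * v m x) + \<Phi> (\<lambda>x. h n x * (1 - u (Suc m) x))"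
          by (intro add continuous_intros hc u v)
        finally show ?thesis
          using h0 v_nonneg u_range
          by (auto intro!: ennreal_plus[symmetric] nonneg mult_nonneg_nonneg continuous_intros hc u v)
      qed
      then have "b m + r (Suc m) = r m"
        unfolding b_def r_def by (subst suminf_add) auto
      with Suc show ?case by (simp add: add.assoc)
    qed
    ultimately have "(\<Sum>k<m. b k) + outer (S - T) \<le> (\<Sum>n. ennreal (\<Phi> (h n)))" for m
      by (metis add_left_mono)
    then have rest: "(\<Sum>k. b k) + outer (S - T) \<le> (\<Sum>n. ennreal (\<Phi> (h n)))"
      by (rule ennreal_suminf_bound_add)
    define c where "c i = (case prod_decode i of (k, n) \<Rightarrow> (\<lambda>x. h n x * v k x))" for i
    have "c \<in> covers (S \<inter> T)"
    proof -
      have "1 \<le> (\<Sum>i. ennreal (c i x))" if x: "x \<in> S" "x \<in> T" for x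
      proof -
        have X: "x \<in> X" using x S by auto
        have "1 \<le> (\<Sum>n. ennreal (h n x))" using h1 x by simp
        also have "\<dots> = (\<Sum>n. ennreal (h n x)) * (\<Sum>k. ennreal (v k x))"
          using suminf_ennreal_eq[OF v_nonneg[OF X] v_sums[OF x(2)]] by simp
        also have "\<dots> = (\<Sum>k. \<Sum>n. ennreal (h n x) * ennreal (v k x))" by simp
        also have "\<dots> = (\<Sum>k. \<Sum>n. ennreal (h n x * v k x))"
          using h0[OF X] v_nonneg[OF X] by (simp only: ennreal_mult)
        also have "\<dots> = (\<Sum>i. case prod_decode i of (k, n) \<Rightarrow> ennreal (h n x * v k x))"
          by (rule suminf_ennreal_2dimen[symmetric]) simp
        finally show ?thesis by (simp add: c_def split_def)
      qed
      then show ?thesis using h0 v_nonneg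
        by (auto simp: covers_def c_def split: prod.split intro!: continuous_intros hc v)
    qed
    then have "outer (S \<inter> T) \<le> (\<Sum>i. ennreal (\<Phi> (c i)))" by (rule outer_le)
    also have "\<dots> = (\<Sum>i. case prod_decode i of (k, n) \<Rightarrow> ennreal (\<Phi> (\<lambda>x. h n x * v k x)))"
      by (simp add: c_def split_def)
    also have "\<dots> = (\<Sum>k. b k)"
      by (rule suminf_ennreal_2dimen) (simp add: b_def)
    finally have "outer (S \<inter> T) + outer (S - T) \<le> (\<Sum>k. b k) + outer (S - T)"
      by (rule add_right_mono)
    with rest show ?thesis by (rule order_trans[rotated])
  qed
  then show ?thesis unfolding T_def[symmetric] outer_def[of S] by (rule INF_greatest)
qed

section \<open>The measure and its comparison with the functional\<close>

definition riesz_measure :: "'x measure" where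
  "riesz_measure = measure_of X (lambda_system X (Pow X) outer) outer"

lemma measure_space_outer: "measure_space X (lambda_system X (Pow X) outer) outer"
  using sigma_algebra.caratheodory_lemma[OF sigma_algebra_Pow outer_measure_space_outer] .

lemma space_riesz_measure [simp]: "space riesz_measure = X"
  and sets_riesz_measure: "sets riesz_measure = lambda_system X (Pow X) outer"
  and emeasure_riesz_measure: "A \<in> sets riesz_measure \<Longrightarrow> emeasure riesz_measure A = outer A"
proof -
  have sa: "sigma_algebra X (lambda_system X (Pow X) outer)"
    using measure_space_outer by (simp add: measure_space_def)
  show "sets riesz_measure = lambda_system X (Pow X) outer"
    unfolding riesz_measure_def by (rule sigma_algebra.sets_measure_of_eq[OF sa])
  then show "A \<in> sets riesz_measure \<Longrightarrow> emeasure riesz_measure A = outer A"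
    unfolding riesz_measure_def
    using emeasure_measure_of_sigma[OF sa] measure_space_outer by (auto simp: measure_space_def)
  show "space riesz_measure = X"
    unfolding riesz_measure_def by (rule sigma_algebra.space_measure_of_eq[OF sa])
qed

text \<open>\<open>outer_split\<close> is the nontrivial half of Caratheodory's condition for the
  set where the positive part of \<open>f - a\<close> is nonzero.\<close>

lemma superlevel_in_sets:
  fixes f :: "'x \<Rightarrow> real"
  assumes "continuous_on X f"
  shows "{x\<in>X. a < f x} \<in> sets riesz_measure"
proof -
  define g where "g x = max 0 (f x - a)" for x
  have g: "continuous_on X g" unfolding g_def by (intro continuous_intros assms)
  have T: "{x\<in>X. a < f x} = {x\<in>X. 0 < g x}" by (auto simp: g_def)
  interpret sigma_algebra X "Pow X" by (rule sigma_algebra_Pow)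
  have "outer S \<le> outer (S \<inter> {x\<in>X. 0 < g x}) + outer (S - {x\<in>X. 0 < g x})" if S: "S \<subseteq> X" for S
  proof -
    have "subadditive (Pow X) outer"
      using outer_measure_space_outer countably_subadditive_subadditive
      unfolding outer_measure_space_def by blast
    from subadditiveD[OF this, of "S \<inter> {x\<in>X. 0 < g x}" "S - {x\<in>X. 0 < g x}"] S
    show ?thesis by (auto simp: Int_Diff_Un)
  qed
  then have "{x\<in>X. 0 < g x} \<in> lambda_system X (Pow X) outer"
    unfolding lambda_system_eq using outer_split[OF g]
    by (auto intro!: antisym simp: g_def)
  then show ?thesis by (simp add: T sets_riesz_measure)
qed

lemma borel_measurable_continuous:
  fixes f :: "'x \<Rightarrow> real"
  shows "continuous_on X f \<Longrightarrow> f \<in> borel_measurable riesz_measure"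
  using superlevel_in_sets by (intro borel_measurableI_greater) simp

sublocale riesz: prob_space riesz_measure
proof
  have X: "X \<in> sets riesz_measure"
    using sets.top[of riesz_measure] by simp
  have "outer X \<le> (\<Sum>n. ennreal (\<Phi> (\<lambda>_. if n = 0 then 1 else 0)))"
  proof (rule outer_le)
    have "(\<Sum>n. ennreal (if n = 0 then 1 else 0 :: real)) = 1"
      by (subst suminf_finite[of "{0}"]) auto
    then show "(\<lambda>n _. if n = 0 then 1 else 0) \<in> covers X" by (simp add: covers_def)
  qed
  also have "\<dots> = 1"
    unfolding const by (subst suminf_finite[of "{0}"]) auto
  finally have "outer X \<le> 1" .
  moreover have "ennreal (\<Phi> (\<lambda>_. 1)) \<le> outer X" by (rule functional_le_outer) auto
  ultimately show "emeasure riesz_measure (space riesz_measure) = 1"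
    using X by (simp add: emeasure_riesz_measure const)
qed

lemma prob_X [simp]: "measure riesz_measure X = 1"
  using riesz.prob_space by simp

lemma integrable_continuous:
  fixes f :: "'x \<Rightarrow> real"
  assumes "continuous_on X f"
  shows "integrable riesz_measure f"
proof -
  have "bounded (f ` X)" using assms compact_X by (intro compact_imp_bounded compact_continuous_image)
  then obtain B where "\<And>x. x \<in> X \<Longrightarrow> norm (f x) \<le> B" by (auto simp: bounded_iff)
  then show ?thesis
    using borel_measurable_continuous[OF assms] by (intro riesz.integrable_const_bound[of _ B]) auto
qed

text \<open>Divided by \<open>w\<close>, the slice of \<open>h\<close> between the levels
  \<open>a\<close> and \<open>a + w\<close> lies below the indicator of \<open>{h > a}\<close>, so
  \<open>functional_le_outer\<close> applies.\<close>

lemma slice_le_prob: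
  assumes h: "continuous_on X h" and w: "0 < w"
  shows "\<Phi> (\<lambda>x. min w (max 0 (h x - a))) \<le> w * measure riesz_measure {x\<in>X. a < h x}"
proof -
  define s where "s x = min w (max 0 (h x - a))" for x
  have s: "continuous_on X s" unfolding s_def by (intro continuous_intros h)
  have "ennreal (\<Phi> (\<lambda>x. (1 / w) * s x)) \<le> outer {x\<in>X. a < h x}"
    using w by (intro functional_le_outer continuous_intros s)
      (auto simp: s_def field_simps indicator_def)
  also have "\<dots> = ennreal (measure riesz_measure {x\<in>X. a < h x})"
    using superlevel_in_sets[OF h] by (simp add: emeasure_riesz_measure[symmetric] riesz.emeasure_eq_measure)
  finally have "(1 / w) * \<Phi> s \<le> measure riesz_measure {x\<in>X. a < h x}"
    using scale[OF s, of "1 / w"] by simp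
  then show ?thesis using w by (simp add: s_def[symmetric] field_simps)
qed

text \<open>Layer-cake argument: \<open>h\<close> is a finite sum of horizontal slices of thickness
  \<open>w\<close>. On the i-th slice \<open>\<Phi>\<close> is at most \<open>w\<close> times the
  measure of \<open>{h > i w}\<close>, and the step function with these weights exceeds
  \<open>h\<close> by at most \<open>w\<close>.\<close>

lemma functional_le_integral_nonneg:
  assumes h: "continuous_on X h" "\<And>x. x \<in> X \<Longrightarrow> 0 \<le> h x"
  shows "\<Phi> h \<le> (\<integral>x. h x \<partial>riesz_measure)"
proof (rule field_le_epsilon)
  fix w :: real assume w: "0 < w"
  have "bounded (h ` X)" using h(1) compact_X by (intro compact_imp_bounded compact_continuous_image)
  then obtain B where B: "\<And>x. x \<in> X \<Longrightarrow> norm (h x) \<le> B" by (auto simp: bounded_iff)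
  obtain N :: nat where N: "B / w < real N" using reals_Archimedean2 by blast
  define s where "s i x = min w (max 0 (h x - real i * w))" for i x
  define A where "A i = {x\<in>X. real i * w < h x}" for i
  have s: "continuous_on X (s i)" for i unfolding s_def by (intro continuous_intros h)
  have slices: "(\<Sum>i<n. s i x) = min (h x) (real n * w)" if "x \<in> X" for n x
    using w h(2)[OF that] by (induction n) (auto simp: s_def algebra_simps min_def max_def)
  have steps: "(\<Sum>i<n. w * indicator (A i) x) \<le> min (h x + w) (real n * w)" if x: "x \<in> X" for n x
  proof (induction n)
    case 0
    then show ?case using w h(2)[OF x] by simp
  next
    case (Suc n)
    define q where "q = (\<Sum>i<n. w * indicator (A i) x)"
    have "q \<le> min (h x + w) (real n * w)" using Suc by (simp only: q_def)
    then have "q + w * indicator (A n) x \<le> min (h x + w) (real (Suc n) * w)"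
      using w x h(2)[OF x] by (auto simp: A_def indicator_def algebra_simps)
    then show ?case by (simp add: q_def)
  qed
  have A: "A i \<in> sets riesz_measure" for i unfolding A_def by (rule superlevel_in_sets[OF h(1)])
  have ind: "integrable riesz_measure (indicator (A i) :: 'x \<Rightarrow> real)" for i
    by (intro integrable_real_indicator A) (simp add: riesz.emeasure_eq_measure)
  have AX: "A i \<inter> X = A i" for i by (auto simp: A_def)
  have hN: "min (h x) (real N * w) = h x" if "x \<in> X" for x
    using B[OF that] N w by (auto simp: field_simps)
  have "\<Phi> h = \<Phi> (\<lambda>x. \<Sum>i<N. s i x)"
    using h s by (intro cong continuous_on_sum) (auto simp: slices hN)
  also have "\<dots> = (\<Sum>i<N. \<Phi> (s i))" by (intro sum s)
  also have "\<dots> \<le> (\<Sum>i<N. w * measure riesz_measure (A i))"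
    unfolding s_def A_def by (intro sum_mono slice_le_prob h(1) w)
  also have "\<dots> = (\<integral>x. (\<Sum>i<N. w * indicator (A i) x) \<partial>riesz_measure)"
    using ind by (subst Bochner_Integration.integral_sum) (auto simp: AX)
  also have "\<dots> \<le> (\<integral>x. h x + w \<partial>riesz_measure)"
  proof (rule integral_mono)
    show "integrable riesz_measure (\<lambda>x. \<Sum>i<N. w * indicator (A i) x)"
      by (intro Bochner_Integration.integrable_sum integrable_mult_right ind)
    show "integrable riesz_measure (\<lambda>x. h x + w)"
      by (intro integrable_continuous continuous_intros h)
    show "(\<Sum>i<N. w * indicator (A i) x) \<le> h x + w" if "x \<in> space riesz_measure" for x
      using steps[of x N] that by simp
  qed
  also have "\<dots> = (\<integral>x. h x \<partial>riesz_measure) + w"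
    using integrable_continuous[OF h(1)] by simp
  finally show "\<Phi> h \<le> (\<integral>x. h x \<partial>riesz_measure) + w" .
qed

lemma functional_le_integral:
  assumes h: "continuous_on X h"
  shows "\<Phi> h \<le> (\<integral>x. h x \<partial>riesz_measure)"
proof -
  have "bounded (h ` X)" using h compact_X by (intro compact_imp_bounded compact_continuous_image)
  then obtain B where B: "\<And>x. x \<in> X \<Longrightarrow> norm (h x) \<le> B" by (auto simp: bounded_iff)
  have "\<Phi> (\<lambda>x. h x + B) \<le> (\<integral>x. h x + B \<partial>riesz_measure)"
    using B by (intro functional_le_integral_nonneg continuous_intros h) (force simp: abs_le_iff)
  also have "\<dots> = (\<integral>x. h x \<partial>riesz_measure) + B"
    using integrable_continuous[OF h] by simp
  also have "\<Phi> (\<lambda>x. h x + B) = \<Phi> h + B" using h by (subst add) (auto simp: const)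
  finally show ?thesis by simp
qed

end

section \<open>Weak convergence and approximation on compact sets\<close>

lemma bounded_linear_to_complex: "bounded_linear (to_complex :: 'k::real_or_complex \<Rightarrow> complex)"
  by (rule bounded_linear_intro[of _ 1]) (auto simp: to_complex_add to_complex_scaleR norm_to_complex)

lemma to_complex_eq_iff: "to_complex x = to_complex y \<longleftrightarrow> x = (y :: 'k::real_or_complex)"
proof
  interpret bounded_linear "to_complex :: 'k \<Rightarrow> complex" by (rule bounded_linear_to_complex)
  assume "to_complex x = to_complex y"
  then show "x = y" using norm_to_complex[of "x - y"] by (simp add: diff)
qed simp

lemma to_complex_one: "to_complex (1 :: 'k::real_or_complex) = 1"
proof -
  have "to_complex (1 :: 'k) \<noteq> 0" using norm_to_complex[of "1 :: 'k"] by auto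
  then show ?thesis using to_complex_mult[of "1 :: 'k" 1] by simp
qed

lemma to_complex_of_real: "to_complex (of_real r :: 'k::real_or_complex) = of_real r"
  using to_complex_scaleR[of r "1 :: 'k"] by (simp add: of_real_def to_complex_one)

context banach_space_over
begin

lemma bounded_linear_smul: "bounded_linear (smul c)"
proof (rule bounded_linear_intro[of _ "norm c"])
  show "smul c (r *\<^sub>R x) = r *\<^sub>R smul c x" for r x
    by (simp add: scale_of_real[symmetric] mult.commute)
qed (simp_all add: scale_right_distrib norm_scale mult.commute)

lemma dual_spaceI:
  assumes "\<And>x y. \<psi> (x + y) = \<psi> x + \<psi> y" "\<And>c x. \<psi> (smul c x) = c * \<psi> x" "continuous_on UNIV \<psi>"
  shows "\<psi> \<in> dual_space smul"
proof -
  have "Vector_Spaces.linear smul (*) \<psi>"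
    by unfold_locales (auto simp: assms algebra_simps)
  then show ?thesis using assms(3) by (simp add: dual_space_def)
qed

text \<open>The weak topology is given by \<open>'k\<close>-valued functionals, the separation by
  real ones. If \<open>'k\<close> is the real line, \<open>\<phi>\<close> only has to be embedded;
  otherwise \<open>\<psi> v = \<phi> v - i \<phi> (i v)\<close> is the usual complex functional with
  real part \<open>\<phi>\<close>.\<close>

lemma complexify_functional:
  fixes \<phi> :: "'e \<Rightarrow> real"
  assumes "bounded_linear \<phi>"
  obtains \<psi> where "\<psi> \<in> dual_space smul" "\<And>v. Re (to_complex (\<psi> v)) = \<phi> v"
proof -
  interpret \<phi>: bounded_linear \<phi> by fact
  interpret t: bounded_linear "to_complex :: 'k \<Rightarrow> complex" by (rule bounded_linear_to_complex)
  have cont: "continuous_on UNIV \<phi>" by (rule linear_continuous_on) fact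
  consider "range (to_complex :: 'k \<Rightarrow> complex) = \<real>" | "range (to_complex :: 'k \<Rightarrow> complex) = UNIV"
    using range_to_complex by blast
  then show thesis
  proof cases
    case 1
    have real: "\<exists>r. c = of_real r" for c :: 'k
    proof -
      have "to_complex c \<in> \<real>" using 1 by blast
      then obtain r where "to_complex c = of_real r" by (auto simp: Reals_def)
      then have "to_complex c = to_complex (of_real r :: 'k)" by (simp add: to_complex_of_real)
      then show ?thesis by (auto simp: to_complex_eq_iff)
    qed
    show thesis
    proof (rule that)
      show "(\<lambda>v. of_real (\<phi> v)) \<in> dual_space smul"
      proof (rule dual_spaceI)
        show "of_real (\<phi> (smul c x)) = c * of_real (\<phi> x)" for c x
          using real[of c] by (auto simp: scale_of_real \<phi>.scaleR)
      qed (auto simp: \<phi>.add intro!: continuous_intros cont)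
    qed (simp add: to_complex_of_real)
  next
    case 2
    obtain i :: 'k where i: "to_complex i = \<i>" using 2 by (metis surjD)
    have ii: "i * i = - 1"
      by (rule to_complex_eq_iff[THEN iffD1]) (simp add: to_complex_mult i t.neg to_complex_one)
    define \<psi> where "\<psi> v = (of_real (\<phi> v) - i * of_real (\<phi> (smul i v)) :: 'k)" for v
    have \<psi>_add: "\<psi> (x + y) = \<psi> x + \<psi> y" for x y
      by (simp add: \<psi>_def scale_right_distrib \<phi>.add algebra_simps)
    have \<psi>_real: "\<psi> (smul (of_real r) x) = of_real r * \<psi> x" for r x
    proof -
      have "smul i (r *\<^sub>R x) = r *\<^sub>R smul i x" by (rule linear_scale[OF bounded_linear.linear[OF bounded_linear_smul]])
      then show ?thesis by (simp add: \<psi>_def scale_of_real \<phi>.scaleR algebra_simps)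
    qed
    have \<psi>_i: "\<psi> (smul i x) = i * \<psi> x" for x
      by (simp add: \<psi>_def ii \<phi>.neg algebra_simps) (simp add: mult.assoc[symmetric] ii)
    show thesis
    proof (rule that)
      show "\<psi> \<in> dual_space smul"
      proof (rule dual_spaceI)
        fix c :: 'k and x
        define a b where "a = Re (to_complex c)" and "b = Im (to_complex c)"
        have "to_complex c = to_complex (of_real a + i * of_real b :: 'k)"
          by (simp add: to_complex_add to_complex_mult to_complex_of_real i a_def b_def complex_eq)
        then have c: "c = of_real a + i * of_real b" by (simp only: to_complex_eq_iff)
        have "smul c x = smul (of_real a) x + smul i (smul (of_real b) x)"
          by (simp only: c scale_left_distrib scale_scale)
        then show "\<psi> (smul c x) = c * \<psi> x"
          by (simp only: \<psi>_add \<psi>_real \<psi>_i) (simp add: c algebra_simps)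
      next
        have "continuous_on UNIV (\<lambda>v. \<phi> (smul i v))"
          by (intro bounded_linear.continuous_on[OF assms]
              bounded_linear.continuous_on[OF bounded_linear_smul] continuous_on_id)
        then show "continuous_on UNIV \<psi>"
          unfolding \<psi>_def by (intro continuous_intros cont)
      qed (rule \<psi>_add)
      show "Re (to_complex (\<psi> v)) = \<phi> v" for v
        by (simp add: \<psi>_def t.diff to_complex_mult to_complex_of_real i)
    qed
  qed
qed

lemma weak_limit_functional:
  fixes \<phi> :: "'e \<Rightarrow> real"
  assumes lim: "limitin (weak_topology smul) f g F" and \<phi>: "bounded_linear \<phi>"
  shows "((\<lambda>n. \<phi> (f n)) \<longlongrightarrow> \<phi> g) F"
proof (rule topological_tendstoI)
  fix U assume U: "open U" "\<phi> g \<in> U"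
  obtain \<psi> where \<psi>: "\<psi> \<in> dual_space smul" "\<And>v. Re (to_complex (\<psi> v)) = \<phi> v"
    using complexify_functional[OF \<phi>] by blast
  have "continuous_on UNIV (\<lambda>c :: 'k. Re (to_complex c))"
    by (intro bounded_linear.continuous_on[OF bounded_linear_Re]
        bounded_linear.continuous_on[OF bounded_linear_to_complex] continuous_on_id)
  then have "open ((\<lambda>c :: 'k. Re (to_complex c)) -` U)"
    using U(1) by (simp add: continuous_on_open_vimage)
  then have "openin (weak_topology smul) (\<psi> -` ((\<lambda>c. Re (to_complex c)) -` U))"
    unfolding weak_topology_def using \<psi>(1) by (intro topology_generated_by_Basis) blast
  from limitinD[OF lim this] U \<psi>(2) show "\<forall>\<^sub>F n in F. \<phi> (f n) \<in> U" by simp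
qed

lemma openin_weak_topology_imp_open:
  assumes "openin (weak_topology smul) U"
  shows "open U"
proof -
  have "generate_topology_on {\<phi> -` U | \<phi> U. \<phi> \<in> dual_space smul \<and> open U} U"
    using assms unfolding weak_topology_def by (rule openin_topology_generated_by)
  then show ?thesis
  proof induction
    case (Basis s)
    then show ?case by (auto simp: dual_space_def intro: open_vimage)
  qed auto
qed

lemma tendsto_imp_limitin_weak:
  assumes "(f \<longlongrightarrow> g) F"
  shows "limitin (weak_topology smul) f g F"
proof -
  \<comment> \<open>\<open>limitin\<close> also demands that \<open>g\<close> lie in the topspace;
    the preimage of \<open>UNIV\<close> under the zero functional shows that this is the whole
    space.\<close>
  have "(\<lambda>_. 0) \<in> dual_space smul" by (rule dual_spaceI) auto
  then have "openin (weak_topology smul) ((\<lambda>_. 0) -` UNIV)"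
    unfolding weak_topology_def by (intro topology_generated_by_Basis) blast
  then have "g \<in> topspace (weak_topology smul)" using openin_subset by fastforce
  then show ?thesis
    using assms by (auto simp: limitin_def intro: topological_tendstoD dest: openin_weak_topology_imp_open)
qed

end

section \<open>The real dual ball with the weak-* topology\<close>

definition dual_ball :: "('e::real_normed_vector \<Rightarrow> real) set" where
  "dual_ball = {\<phi>. linear \<phi> \<and> (\<forall>v. \<bar>\<phi> v\<bar> \<le> norm v)}"

lemma bounded_linear_dual_ball: "\<phi> \<in> dual_ball \<Longrightarrow> bounded_linear \<phi>"
  unfolding dual_ball_def
  by (auto intro!: bounded_linear_intro[of _ 1] simp: linear_add linear_scale)

text \<open>Banach--Alaoglu: the topology of \<open>'e \<Rightarrow> real\<close> is that of
  pointwise convergence, and the ball is cut out by closed conditions, the linearity equations, from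
  a product of compact intervals.\<close>

lemma compact_dual_ball: "compact (dual_ball :: ('e::real_normed_vector \<Rightarrow> real) set)"
proof -
  have eval: "continuous_on UNIV (\<lambda>\<phi> :: 'e \<Rightarrow> real. \<phi> v)" for v
    by (rule continuous_on_product_coordinates)
  have "compactin (product_topology (\<lambda>_. euclidean) UNIV) (PiE UNIV (\<lambda>v :: 'e. cball (0 :: real) (norm v)))"
    unfolding compactin_PiE by simp
  then have box: "compact (PiE UNIV (\<lambda>v :: 'e. cball (0 :: real) (norm v)))"
    by (simp only: euclidean_product_topology compactin_euclidean_iff)
  have eq: "dual_ball = PiE UNIV (\<lambda>v :: 'e. cball (0 :: real) (norm v)) \<inter>
      ((\<Inter>x. \<Inter>y. {\<phi>. \<phi> (x + y) = \<phi> x + \<phi> y}) \<inter> (\<Inter>r. \<Inter>x. {\<phi>. \<phi> (r *\<^sub>R x) = r * \<phi> x}))"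
    by (auto simp: dual_ball_def linear_iff)
  show ?thesis
    unfolding eq by (intro compact_Int_closed[OF box] closed_Int closed_INT ballI
        closed_Collect_eq continuous_intros eval)
qed

text \<open>Joint continuity comes from the split
  \<open>\<phi> (g x) = \<phi> (g x - g x0) + \<phi> (g x0)\<close>: the first term is at most
  \<open>norm (g x - g x0)\<close> uniformly in \<open>\<phi>\<close>, the second is a coordinate of
  \<open>\<phi>\<close>.\<close>

lemma continuous_on_evaluation:
  fixes g :: "'a::topological_space \<Rightarrow> 'e::real_normed_vector"
  assumes g: "continuous_on L g"
  shows "continuous_on (L \<times> dual_ball) (\<lambda>p. snd p (g (fst p)))"
  unfolding continuous_on_def
proof
  fix p0 :: "'a \<times> ('e \<Rightarrow> real)" assume p0: "p0 \<in> L \<times> dual_ball"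
  let ?F = "at p0 within L \<times> dual_ball"
  have in_X: "\<forall>\<^sub>F p in ?F. p \<in> L \<times> dual_ball"
    by (simp add: eventually_at_filter)
  have "continuous_on (L \<times> dual_ball) (\<lambda>p :: 'a \<times> ('e \<Rightarrow> real). g (fst p) - g (fst p0))"
    by (intro continuous_intros continuous_on_compose2[OF g]) auto
  then have "((\<lambda>p. g (fst p) - g (fst p0)) \<longlongrightarrow> g (fst p0) - g (fst p0)) ?F"
    using p0 unfolding continuous_on_def by blast
  then have g0: "((\<lambda>p. g (fst p) - g (fst p0)) \<longlongrightarrow> 0) ?F" by simp
  have "((\<lambda>p. snd p (g (fst p) - g (fst p0))) \<longlongrightarrow> 0) ?F"
    by (rule Lim_null_comparison[OF _ tendsto_norm_zero[OF g0]])
      (rule eventually_mono[OF in_X], auto simp: dual_ball_def)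
  moreover have "((\<lambda>p. snd p (g (fst p0))) \<longlongrightarrow> snd p0 (g (fst p0))) ?F"
  proof -
    have "continuous_on (L \<times> dual_ball) (\<lambda>p :: 'a \<times> ('e \<Rightarrow> real). snd p (g (fst p0)))"
      by (rule continuous_on_compose2[OF continuous_on_product_coordinates, of _ snd])
        (auto intro: continuous_intros)
    then show ?thesis using p0 unfolding continuous_on_def by blast
  qed
  ultimately have "((\<lambda>p. snd p (g (fst p) - g (fst p0)) + snd p (g (fst p0)))
      \<longlongrightarrow> 0 + snd p0 (g (fst p0))) ?F"
    by (rule tendsto_add)
  moreover have "\<forall>\<^sub>F p in ?F. snd p (g (fst p) - g (fst p0)) + snd p (g (fst p0)) = snd p (g (fst p))"
    using in_X by eventually_elim (auto simp: dual_ball_def linear_diff)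
  ultimately show "((\<lambda>p. snd p (g (fst p))) \<longlongrightarrow> snd p0 (g (fst p0))) ?F"
    by (simp add: filterlim_cong[OF refl refl, THEN iffD1])
qed

lemma restrict_bcontfun_linfty: "restrict (apply_bcontfun g) L \<in> linfty L"
proof -
  have "bounded (apply_bcontfun g ` L)"
    by (rule bounded_subset[OF bounded_apply_bcontfun[of g]]) auto
  then show ?thesis by (simp add: linfty_def)
qed

lemma (in banach_space_over) M_hull_approx:
  fixes K :: "('z::topological_space \<Rightarrow>\<^sub>C 'e) set"
  assumes L: "compact L" and K: "convex K" and e: "0 < e"
    and f: "restrict (apply_bcontfun f) L \<in> M_hull smul L ((\<lambda>g. restrict (apply_bcontfun g) L) ` K)"
  shows "\<exists>k\<in>K. \<forall>x\<in>L. norm (apply_bcontfun f x - apply_bcontfun k x) < e"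
proof (rule ccontr)
  assume "\<not> ?thesis"
  then have far: "\<exists>x\<in>L. e \<le> norm (apply_bcontfun f x - apply_bcontfun k x)" if "k \<in> K" for k
    using that by (auto simp: not_less)
  let ?A = "(\<lambda>g. restrict (apply_bcontfun g) L) ` K"
  have A: "?A \<subseteq> linfty L" using restrict_bcontfun_linfty by blast
  \<comment> \<open>The empty set satisfies (M1), as a sequence needs members; so the hull of the
    empty set is empty and cannot contain \<open>f\<close>.\<close>
  have "K \<noteq> {}"
  proof
    assume "K = {}"
    then have "M_hull smul L ?A \<subseteq> {}"
      by (intro M_hull_smallest(4)[OF A]) (auto simp: weakly_seq_closed_def)
    then show False using f by blast
  qed
  define X where "X = L \<times> (dual_ball :: ('e \<Rightarrow> real) set)"
  define d where "d h p = snd p (apply_bcontfun f (fst p) - h (fst p))"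
    for h :: "'z \<Rightarrow> 'e" and p :: "'z \<times> ('e \<Rightarrow> real)"
  define D where "D = (\<lambda>k. d (apply_bcontfun k)) ` K"
  have X: "compact X" unfolding X_def by (intro compact_Times L compact_dual_ball)
  have d_cont: "continuous_on X (d (apply_bcontfun k))" for k
    unfolding X_def d_def by (rule continuous_on_evaluation) (intro continuous_intros; simp)
  have conv: "\<exists>c\<in>D. \<forall>p\<in>X. c p = (1 - t) * d1 p + t * d2 p"
    if D: "d1 \<in> D" "d2 \<in> D" and t: "0 \<le> t" "t \<le> 1" for d1 d2 t
  proof -
    obtain k1 k2 where k: "k1 \<in> K" "k2 \<in> K" "d1 = d (apply_bcontfun k1)" "d2 = d (apply_bcontfun k2)"
      using D by (auto simp: D_def)
    let ?k = "(1 - t) *\<^sub>R k1 + t *\<^sub>R k2"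
    have "?k \<in> K" using k t K by (simp add: convex_alt)
    moreover have "d (apply_bcontfun ?k) p = (1 - t) * d1 p + t * d2 p" if "p \<in> X" for p
    proof -
      have lin: "linear (snd p)" using that by (auto simp: X_def dual_ball_def)
      let ?f = "apply_bcontfun f (fst p)"
      have "?f - apply_bcontfun ?k (fst p) =
          (1 - t) *\<^sub>R (?f - apply_bcontfun k1 (fst p)) + t *\<^sub>R (?f - apply_bcontfun k2 (fst p))"
        by (simp add: algebra_simps)
      then show ?thesis unfolding k d_def by (simp only: linear_add[OF lin] linear_scale[OF lin] real_scaleR_def)
    qed
    ultimately show ?thesis unfolding D_def by blast
  qed
  have "\<exists>p\<in>X. e \<le> c p" if c: "c \<in> D" for c
  proof -
    obtain k where k: "k \<in> K" "c = d (apply_bcontfun k)" using c by (auto simp: D_def)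
    obtain x where x: "x \<in> L" "e \<le> norm (apply_bcontfun f x - apply_bcontfun k x)" using far[OF k(1)] by auto
    obtain \<phi> :: "'e \<Rightarrow> real" where \<phi>: "linear \<phi>" "\<And>v. \<bar>\<phi> v\<bar> \<le> norm v"
      "norm (apply_bcontfun f x - apply_bcontfun k x) \<le> \<phi> (apply_bcontfun f x - apply_bcontfun k x)"
      using norming_functional by blast
    then have "(x, \<phi>) \<in> X" "e \<le> c (x, \<phi>)" using x by (auto simp: X_def dual_ball_def k d_def)
    then show ?thesis by blast
  qed
  then obtain \<Phi> where \<Phi>: "positive_functional X \<Phi>" "\<And>c. c \<in> D \<Longrightarrow> e \<le> \<Phi> c"
    using separating_positive_functional[OF X, of D e] \<open>K \<noteq> {}\<close> d_cont conv
    unfolding D_def by blast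
  interpret positive_functional X \<Phi> by (rule \<Phi>(1))
  \<comment> \<open>\<open>B\<close> will be shown to contain the restrictions of \<open>K\<close>
    and to satisfy (M1), hence to contain the hull. Measurability is carried along because members
    of the hull need not be continuous; it survives pointwise limits of sequences.\<close>
  define B where "B = {h \<in> linfty L. d h \<in> borel_measurable riesz_measure \<and>
    e \<le> (\<integral>p. d h p \<partial>riesz_measure)}"
  have restrict_d: "d (restrict h L) p = d h p" if "p \<in> X" for h p
    using that by (auto simp: d_def X_def)
  have "?A \<subseteq> B"
  proof
    fix h assume "h \<in> ?A"
    then obtain k where k: "k \<in> K" "h = restrict (apply_bcontfun k) L" by blast
    have "d h \<in> borel_measurable riesz_measure"
      using borel_measurable_continuous[OF d_cont[of k]]
      by (subst measurable_cong[of _ _ "d (apply_bcontfun k)"]) (auto simp: k restrict_d)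
    moreover have "e \<le> \<Phi> (d (apply_bcontfun k))" using \<Phi>(2) k by (auto simp: D_def)
    then have "e \<le> (\<integral>p. d (apply_bcontfun k) p \<partial>riesz_measure)"
      using functional_le_integral[OF d_cont[of k]] by simp
    then have "e \<le> (\<integral>p. d h p \<partial>riesz_measure)"
      by (subst Bochner_Integration.integral_cong[of _ riesz_measure _ "d (apply_bcontfun k)"]) (auto simp: k restrict_d)
    ultimately show "h \<in> B" using restrict_bcontfun_linfty k by (simp add: B_def)
  qed
  moreover have "weakly_seq_closed smul L B"
    unfolding weakly_seq_closed_def
  proof (intro allI impI, elim conjE exE)
    fix h :: "nat \<Rightarrow> 'z \<Rightarrow> 'e" and g C
    assume h: "\<forall>n. h n \<in> B" and C: "\<forall>n. \<forall>z\<in>L. norm (h n z) \<le> C" and g: "g \<in> linfty L"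
      and lim: "\<forall>z\<in>L. limitin (weak_topology smul) (\<lambda>n. h n z) (g z) sequentially"
    obtain b where b: "\<And>x. norm (apply_bcontfun f x) \<le> b"
      using bounded_apply_bcontfun[of f] by (auto simp: bounded_iff)
    have meas: "d (h n) \<in> borel_measurable riesz_measure" for n using h by (simp add: B_def)
    have conv_d: "(\<lambda>n. d (h n) p) \<longlonglongrightarrow> d g p" if p: "p \<in> X" for p
    proof -
      have "snd p \<in> dual_ball" "fst p \<in> L" using p by (auto simp: X_def)
      then have bl: "bounded_linear (snd p)" by (simp add: bounded_linear_dual_ball)
      then have "(\<lambda>n. snd p (h n (fst p))) \<longlonglongrightarrow> snd p (g (fst p))"
        using lim \<open>fst p \<in> L\<close> by (intro weak_limit_functional) auto
      then show ?thesis
        unfolding d_def linear_diff[OF bounded_linear.linear[OF bl]] by (intro tendsto_intros)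
    qed
    have meas_g: "d g \<in> borel_measurable riesz_measure"
      by (rule borel_measurable_LIMSEQ_real[OF _ meas]) (use conv_d in auto)
    have bound: "norm (d (h n) p) \<le> b + C" if "p \<in> X" for n p
    proof -
      have "norm (d (h n) p) \<le> norm (apply_bcontfun f (fst p) - h n (fst p))"
        using that by (auto simp: d_def X_def dual_ball_def)
      also have "\<dots> \<le> norm (apply_bcontfun f (fst p)) + norm (h n (fst p))" by (rule norm_triangle_ineq4)
      also have "\<dots> \<le> b + C" using b C that by (intro add_mono) (auto simp: X_def)
      finally show ?thesis .
    qed
    have "(\<lambda>n. \<integral>p. d (h n) p \<partial>riesz_measure) \<longlonglongrightarrow> (\<integral>p. d g p \<partial>riesz_measure)"
      by (rule integral_dominated_convergence[where w = "\<lambda>_. b + C"])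
        (use meas meas_g conv_d bound in auto)
    moreover have "e \<le> (\<integral>p. d (h n) p \<partial>riesz_measure)" for n using h by (simp add: B_def)
    ultimately have "e \<le> (\<integral>p. d g p \<partial>riesz_measure)" by (intro LIMSEQ_le_const) auto
    then show "g \<in> B" using g meas_g by (simp add: B_def)
  qed
  ultimately have "M_hull smul L ?A \<subseteq> B"
    by (intro M_hull_smallest(4)[OF A]) (auto simp: B_def)
  then have "restrict (apply_bcontfun f) L \<in> B" using f by blast
  then have "e \<le> (\<integral>p. d (restrict (apply_bcontfun f) L) p \<partial>riesz_measure)" by (simp add: B_def)
  \<comment> \<open>For \<open>h = f\<close> the integrand vanishes on \<open>X\<close>,
    contradicting the lower bound \<open>e > 0\<close>.\<close>
  also have "\<dots> = (\<integral>p. 0 \<partial>riesz_measure)"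
  proof (rule Bochner_Integration.integral_cong)
    show "d (restrict (apply_bcontfun f) L) p = 0" if "p \<in> space riesz_measure" for p
      using that by (auto simp: restrict_d) (auto simp: d_def X_def dual_ball_def linear_0)
  qed simp
  finally show False using e by simp
qed

section \<open>Gliding hump\<close>

lemma apply_bcontfun_sum:
  "apply_bcontfun (\<Sum>i\<in>I. f i) x = (\<Sum>i\<in>I. apply_bcontfun (f i) x)"
  by (induction I rule: infinite_finite_induct) auto

text \<open>Each new approximant \<open>k\<^sub>n\<close> is chosen close to \<open>f\<close> on a compact set outside which
  \<open>f, k\<^sub>0, \<dots>, k\<^sub>n\<^sub>-\<^sub>1\<close> are all small. At a given point at most one of them is then far from \<open>f\<close>,
  and a long average is uniformly close to \<open>f\<close>.\<close>

lemma gliding_hump: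
  fixes K :: "('a::topological_space \<Rightarrow>\<^sub>C 'e::real_normed_vector) set"
  assumes K: "convex K" "K \<subseteq> C0" and f: "f \<in> C0" and \<epsilon>: "0 < \<epsilon>"
    and approx: "\<And>L. compact L \<Longrightarrow> \<exists>k\<in>K. norm k \<le> C \<and>
      (\<forall>x\<in>L. norm (apply_bcontfun f x - apply_bcontfun k x) \<le> \<epsilon>)"
  shows "\<exists>k\<in>K. dist k f \<le> 3 * \<epsilon>"
proof -
  obtain k where k: "\<And>L. compact L \<Longrightarrow> k L \<in> K" "\<And>L. compact L \<Longrightarrow> norm (k L) \<le> C"
    "\<And>L x. compact L \<Longrightarrow> x \<in> L \<Longrightarrow> norm (apply_bcontfun f x - apply_bcontfun (k L) x) \<le> \<epsilon>"
    using approx by metis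
  have "\<exists>S. compact S \<and> (\<forall>x. x \<notin> S \<longrightarrow> norm (apply_bcontfun g x) < \<epsilon>)" if "g \<in> C0" for g :: "'a \<Rightarrow>\<^sub>C 'e"
    using that \<epsilon> unfolding C0_def by blast
  then obtain S :: "('a \<Rightarrow>\<^sub>C 'e) \<Rightarrow> 'a set" where S: "\<And>g. g \<in> C0 \<Longrightarrow> compact (S g)"
    "\<And>g x. g \<in> C0 \<Longrightarrow> x \<notin> S g \<Longrightarrow> norm (apply_bcontfun g x) < \<epsilon>"
    by metis
  \<comment> \<open>Outside \<open>L (Suc n)\<close> the approximant chosen for \<open>L n\<close>
    is small, and outside every \<open>L n\<close> so is \<open>f\<close>.\<close>
  define L where "L = rec_nat (S f) (\<lambda>_ L. L \<union> S (k L))"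
  have L_0: "L 0 = S f" and L_Suc: "L (Suc n) = L n \<union> S (k (L n))" for n
    by (simp_all add: L_def)
  have L: "compact (L n)" for n
  proof (induction n)
    case (Suc n)
    then have "k (L n) \<in> C0" using k(1) K(2) by blast
    then show ?case using Suc.IH S(1) by (simp add: L_Suc compact_Un)
  qed (simp add: L_0 S(1)[OF f])
  have L_mono: "L m \<subseteq> L n" if "m \<le> n" for m n
    by (rule lift_Suc_mono_le[of L, OF _ that]) (auto simp: L_Suc)
  define g where "g n = k (L n)" for n
  have gK: "g n \<in> K" and g_norm: "norm (g n) \<le> C" for n using k L by (auto simp: g_def)
  have C0: "0 \<le> C" using order_trans[OF norm_ge_zero g_norm] .
  have one_bad: "\<exists>j. \<forall>n. n \<noteq> j \<longrightarrow> norm (apply_bcontfun f x - apply_bcontfun (g n) x) \<le> 2 * \<epsilon>" for x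
  proof -
    \<comment> \<open>On \<open>L n\<close> the n-th approximant is \<open>\<epsilon>\<close>-close
      to \<open>f\<close>; outside \<open>L (Suc n)\<close> both are below
      \<open>\<epsilon>\<close>. The sets \<open>L (Suc n) - L n\<close> are disjoint, so at most
      one index fails.\<close>
    have good: "norm (apply_bcontfun f x - apply_bcontfun (g n) x) \<le> 2 * \<epsilon>"
      if "x \<in> L n \<or> x \<notin> L (Suc n)" for n
    proof (cases "x \<in> L n")
      case True
      then show ?thesis using k(3)[OF L, of x n] \<epsilon> by (simp add: g_def)
    next
      case False
      then have "x \<notin> S (g n)" "x \<notin> S f" using that L_mono[of 0 n] by (auto simp: L_Suc L_0 g_def)
      then have "norm (apply_bcontfun (g n) x) < \<epsilon>" "norm (apply_bcontfun f x) < \<epsilon>"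
        using S(2) gK K(2) f by blast+
      then show ?thesis
        using norm_triangle_ineq4[of "apply_bcontfun f x" "apply_bcontfun (g n) x"] by simp
    qed
    show ?thesis
    proof (cases "\<exists>m. x \<notin> L m \<and> x \<in> L (Suc m)")
      case True
      then obtain m where m: "x \<notin> L m" "x \<in> L (Suc m)" by blast
      have "x \<in> L n \<or> x \<notin> L (Suc n)" if "n \<noteq> m" for n
      proof (cases "n < m")
        case True
        then have "L (Suc n) \<subseteq> L m" by (intro L_mono) simp
        then show ?thesis using m by blast
      next
        case False
        then have "L (Suc m) \<subseteq> L n" using that by (intro L_mono) simp
        then show ?thesis using m by blast
      qed
      then show ?thesis using good by blast
    qed (use good in blast)
  qed
  \<comment> \<open>In the average, the one bad index contributes at most
    \<open>(norm f + C) / N < \<epsilon>\<close> on top of the \<open>2 * \<epsilon>\<close> of the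
    others.\<close>
  obtain N :: nat where N: "(norm f + C) / \<epsilon> < real N" using reals_Archimedean2 by blast
  have "0 \<le> (norm f + C) / \<epsilon>" using C0 \<epsilon> by simp
  then have N0: "0 < real N" using N by linarith
  define h where "h = (\<Sum>n<N. (1 / real N) *\<^sub>R g n)"
  have "h \<in> K" unfolding h_def using gK N0 by (intro convex_sum K) auto
  moreover have "dist h f \<le> 3 * \<epsilon>"
  proof (rule dist_bound)
    fix x
    obtain j where j: "\<And>n. n \<noteq> j \<Longrightarrow> norm (apply_bcontfun f x - apply_bcontfun (g n) x) \<le> 2 * \<epsilon>"
      using one_bad by blast
    have le: "norm (apply_bcontfun f x - apply_bcontfun (g n) x) \<le> 2 * \<epsilon> + (if n = j then norm f + C else 0)" for n
    proof (cases "n = j")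
      case True
      have "norm (apply_bcontfun f x - apply_bcontfun (g n) x) \<le> norm f + C"
        by (intro order_trans[OF norm_triangle_ineq4] add_mono norm_bounded order_trans[OF norm_bounded g_norm])
      then show ?thesis using True \<epsilon> by simp
    qed (use j in auto)
    have "apply_bcontfun h x - apply_bcontfun f x =
        - (\<Sum>n<N. (1 / real N) *\<^sub>R (apply_bcontfun f x - apply_bcontfun (g n) x))"
      using N0 by (simp add: h_def apply_bcontfun_sum scaleR_diff_right sum_subtractf scaleR_sum_right[symmetric]
          del: scaleR_sum_right) (simp add: sum_constant_scaleR)
    then have "dist (apply_bcontfun h x) (apply_bcontfun f x) =
        norm (\<Sum>n<N. (1 / real N) *\<^sub>R (apply_bcontfun f x - apply_bcontfun (g n) x))"
      by (simp add: dist_norm)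
    also have "\<dots> \<le> (\<Sum>n<N. (1 / real N) * (2 * \<epsilon> + (if n = j then norm f + C else 0)))"
    proof (rule sum_norm_le)
      show "norm ((1 / real N) *\<^sub>R (apply_bcontfun f x - apply_bcontfun (g n) x))
          \<le> (1 / real N) * (2 * \<epsilon> + (if n = j then norm f + C else 0))" for n
        using mult_left_mono[OF le[of n], of "1 / real N"] by simp
    qed
    also have "\<dots> = (1 / real N) * ((\<Sum>n<N. 2 * \<epsilon>) + (\<Sum>n<N. if n = j then norm f + C else 0))"
      by (simp only: sum_distrib_left[symmetric] sum.distrib)
    also have "\<dots> \<le> (1 / real N) * (real N * (2 * \<epsilon>) + (norm f + C))"
      using C0 by (intro mult_left_mono add_mono) auto
    also have "\<dots> \<le> 3 * \<epsilon>"
      using N N0 \<epsilon> by (simp add: field_simps)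
    finally show "dist (apply_bcontfun h x) (apply_bcontfun f x) \<le> 3 * \<epsilon>" .
  qed
  ultimately show ?thesis by blast
qed

section \<open>Truncation in C*-algebras\<close>

context cstar_algebra
begin

lemma norm_star: "norm (star x) = norm x"
proof -
  have le: "norm x \<le> norm (star x)" for x
  proof (cases "x = 0")
    case False
    have "(norm x)\<^sup>2 \<le> norm (star x) * norm x"
      using norm_mult_le[of "star x" x] by (simp add: cstar_identity)
    then show ?thesis using False by (simp add: power2_eq_square)
  qed simp
  show ?thesis using le[of x] le[of "star x"] by (simp add: star_star)
qed

lemma mult_diff_left: "amul (x - y) z = amul x z - amul y z"
  using mult_add_left[of "x - y" y z] by (simp add: algebra_simps)

lemma mult_diff_right: "amul x (y - z) = amul x y - amul x z"
  using mult_add_right[of x "y - z" z] by (simp add: algebra_simps)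

lemma star_diff: "star (x - y) = star x - star y"
  using star_add[of "x - y" y] by (simp add: algebra_simps)

text \<open>The factors \<open>\<alpha> + i\<beta>a\<close> and \<open>\<alpha> - i\<beta>a\<close> are adjoint to each other, with product
  \<open>\<alpha>\<^sup>2 + \<beta>\<^sup>2a\<^sup>2\<close>.\<close>

lemma norm_affine_le:
  assumes a: "star a = a"
  shows "norm (smul (of_real \<alpha>) x + smul (\<i> * of_real \<beta>) (amul a x))
    \<le> sqrt (\<alpha>\<^sup>2 + \<beta>\<^sup>2 * (norm a)\<^sup>2) * norm x"
proof -
  let ?y = "smul (of_real \<alpha>) x + smul (\<i> * of_real \<beta>) (amul a x)"
  let ?ax = "amul a x"
  have "amul (star ?y) ?y = smul (of_real (\<alpha>\<^sup>2)) (amul (star x) x) + smul (of_real (\<beta>\<^sup>2)) (amul (star ?ax) ?ax)"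
    by (simp add: star_add star_scale star_mult a mult_add_left mult_add_right mult_diff_left mult_scale_left
        scale_right_diff_distrib mult_scale_right mult_assoc power2_eq_square scale_right_distrib algebra_simps)
  then have "(norm ?y)\<^sup>2 = norm (smul (of_real (\<alpha>\<^sup>2)) (amul (star x) x) + smul (of_real (\<beta>\<^sup>2)) (amul (star ?ax) ?ax))"
    using cstar_identity[of ?y] by simp
  also have "\<dots> \<le> \<alpha>\<^sup>2 * (norm x)\<^sup>2 + \<beta>\<^sup>2 * (norm ?ax)\<^sup>2"
    by (rule order_trans[OF norm_triangle_ineq]) (simp add: norm_scale cstar_identity del: of_real_power)
  also have "\<dots> \<le> \<alpha>\<^sup>2 * (norm x)\<^sup>2 + \<beta>\<^sup>2 * (norm a * norm x)\<^sup>2"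
    by (intro add_left_mono mult_left_mono power_mono norm_mult_le) auto
  also have "\<dots> = (\<alpha>\<^sup>2 + \<beta>\<^sup>2 * (norm a)\<^sup>2) * (norm x)\<^sup>2"
    by (simp add: algebra_simps power_mult_distrib)
  finally have "sqrt ((norm ?y)\<^sup>2) \<le> sqrt ((\<alpha>\<^sup>2 + \<beta>\<^sup>2 * (norm a)\<^sup>2) * (norm x)\<^sup>2)"
    by (rule real_sqrt_le_mono)
  then show ?thesis by (simp add: real_sqrt_mult)
qed

text \<open>Solving \<open>q + i s a q = x\<close> by the relaxed iteration \<open>q \<mapsto> q - (q + i s a q - x) / c\<close>.\<close>

definition relax :: "real \<Rightarrow> real \<Rightarrow> 'e \<Rightarrow> 'e \<Rightarrow> 'e \<Rightarrow> 'e" where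
  "relax c s a x q = smul (of_real (1 - 1 / c)) q + smul (\<i> * of_real (- s / c)) (amul a q) + smul (of_real (1 / c)) x"

text \<open>With \<open>t = 1 / c\<close>, the bound from \<open>norm_affine_le\<close> for the
  linear part is the square root of \<open>(1 - t)^2 + t^2 s^2 R^2\<close>. This is least at
  \<open>c = 1 + s^2 R^2\<close>, where it equals \<open>1 - 1 / c\<close> under the root. A bound
  \<open>R\<close> in place of \<open>norm a\<close> lets one rate serve all values of a
  function.\<close>

lemma relax_contraction:
  assumes a: "star a = a" "norm a \<le> R" and c: "c = 1 + s\<^sup>2 * R\<^sup>2"
  shows "dist (relax c s a x p) (relax c s a x q) \<le> sqrt (1 - 1 / c) * dist p q"
proof -
  have c1: "1 \<le> c" using c by simp
  have "relax c s a x p - relax c s a x q =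
      smul (of_real (1 - 1 / c)) (p - q) + smul (\<i> * of_real (- s / c)) (amul a (p - q))"
    by (simp add: relax_def mult_diff_right scale_right_diff_distrib)
  then have "dist (relax c s a x p) (relax c s a x q)
      \<le> sqrt ((1 - 1 / c)\<^sup>2 + (- s / c)\<^sup>2 * (norm a)\<^sup>2) * norm (p - q)"
    using norm_affine_le[OF a(1), of "1 - 1 / c" "p - q" "- s / c"] by (simp add: dist_norm)
  also have "\<dots> \<le> sqrt (1 - 1 / c) * norm (p - q)"
  proof (intro mult_right_mono real_sqrt_le_mono)
    have "(- s / c)\<^sup>2 * (norm a)\<^sup>2 \<le> (- s / c)\<^sup>2 * R\<^sup>2"
      using a(2) by (intro mult_left_mono power_mono) auto
    also have "\<dots> = (c - 1) / c\<^sup>2" by (simp add: c power_divide)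
    finally have "(1 - 1 / c)\<^sup>2 + (- s / c)\<^sup>2 * (norm a)\<^sup>2 \<le> (1 - 1 / c)\<^sup>2 + (c - 1) / c\<^sup>2" by simp
    also have "\<dots> = 1 - 1 / c" using c1 by (simp add: field_simps power2_eq_square)
    finally show "(1 - 1 / c)\<^sup>2 + (- s / c)\<^sup>2 * (norm a)\<^sup>2 \<le> 1 - 1 / c" .
  qed simp
  finally show ?thesis by (simp add: dist_norm)
qed

lemma relax_fixpoint:
  assumes "0 < c" "relax c s a x q = q"
  shows "q + smul (\<i> * of_real s) (amul a q) = x"
proof -
  have "smul (of_real c) (relax c s a x q) = smul (of_real c) q" using assms by simp
  then have "smul (of_real c - 1) q + smul (- (\<i> * of_real s)) (amul a q) + x = smul (of_real c) q"
    using assms(1) by (simp add: relax_def scale_right_distrib algebra_simps)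
  then show ?thesis by (simp add: scale_left_diff_distrib algebra_simps)
qed

text \<open>The relaxation makes the map a contraction for every real \<open>s\<close>, however
  large \<open>s a\<close> is; both signs of \<open>s\<close> are used below.\<close>

lemma resolvent_exists:
  assumes a: "star a = a"
  shows "\<exists>q. q + smul (\<i> * of_real s) (amul a q) = x"
proof -
  define c where "c = 1 + s\<^sup>2 * (norm a)\<^sup>2"
  have c: "1 \<le> c" by (simp add: c_def)
  have "\<exists>!q. relax c s a x q = q"
  proof (rule banach_fix_type)
    show "\<forall>p q. dist (relax c s a x p) (relax c s a x q) \<le> sqrt (1 - 1 / c) * dist p q"
      using relax_contraction[OF a order_refl c_def] by blast
  qed (use c in auto)
  then obtain q where "relax c s a x q = q" by blast
  then show ?thesis using relax_fixpoint[of c s a x q] c by auto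
qed

text \<open>With \<open>q\<close> solving \<open>(1 - isa)q = (1 + isa)p = x\<close> and \<open>r = (p + q)/2\<close> one has
  \<open>p = (1 - isa)r\<close> and \<open>q = (1 + isa)r\<close>, hence \<open>p\<^sup>*p = x\<^sup>*r = q\<^sup>*q\<close>.\<close>

lemma norm_le_norm_resolvent:
  assumes a: "star a = a"
  shows "norm p \<le> norm (p + smul (\<i> * of_real s) (amul a p))"
proof -
  define x where "x = p + smul (\<i> * of_real s) (amul a p)"
  \<comment> \<open>Formally \<open>q = (1 - isa)^-1 (1 + isa) p\<close> is the image of
    \<open>p\<close> under the Cayley transform of \<open>sa\<close>, a unitary, so \<open>q\<close>
    should have the same norm as \<open>p\<close>.\<close>
  obtain q where "q + smul (\<i> * of_real (- s)) (amul a q) = x"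
    using resolvent_exists[OF a] by blast
  then have q: "q = x + smul (\<i> * of_real s) (amul a q)"
    by (simp add: scale_minus_left algebra_simps)
  define r where "r = smul (1 / 2) (p + q)"
  have half: "smul (1 / 2) v + smul (1 / 2) v = v" for v
    by (simp add: scale_left_distrib[symmetric])
  have pq: "p + q + smul (\<i> * of_real s) (amul a (p + q)) = q + q"
           "p + q - smul (\<i> * of_real s) (amul a (p + q)) = p + p"
    using q by (simp_all add: x_def mult_add_right scale_right_distrib algebra_simps)
  have q_r: "q = r + smul (\<i> * of_real s) (amul a r)"
  proof -
    have "r + smul (\<i> * of_real s) (amul a r) = smul (1 / 2) (p + q + smul (\<i> * of_real s) (amul a (p + q)))"
      by (simp add: r_def scale_right_distrib mult_add_right mult_scale_right mult.commute)
    then show ?thesis by (simp only: pq scale_right_distrib half)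
  qed
  have p_r: "p = r - smul (\<i> * of_real s) (amul a r)"
  proof -
    have "r - smul (\<i> * of_real s) (amul a r) = smul (1 / 2) (p + q - smul (\<i> * of_real s) (amul a (p + q)))"
      by (simp add: r_def scale_right_distrib scale_right_diff_distrib mult_add_right mult_scale_right mult.commute)
    then show ?thesis by (simp only: pq scale_right_distrib half)
  qed
  have "amul (star p) p = amul (star p) (r - smul (\<i> * of_real s) (amul a r))"
    using p_r by simp
  also have "\<dots> = amul (star x) r"
    by (simp add: x_def star_add star_scale star_mult a mult_diff_right mult_add_left mult_diff_left
        mult_scale_right mult_scale_left mult_assoc scale_minus_left)
  finally have pp: "amul (star p) p = amul (star x) r" .
  have x_q: "x = q - smul (\<i> * of_real s) (amul a q)" using q by (simp add: algebra_simps)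
  have "amul (star q) q = amul (star q) (r + smul (\<i> * of_real s) (amul a r))"
    using q_r by simp
  also have "\<dots> = amul (star x) r"
    unfolding x_q
    by (simp add: star_diff star_scale star_mult a mult_add_right mult_add_left mult_diff_left
        mult_scale_right mult_scale_left mult_assoc scale_minus_left)
  finally have "(norm q)\<^sup>2 = (norm p)\<^sup>2" using pp cstar_identity by metis
  then have qp: "norm q = norm p" by simp
  have "norm r \<le> norm p"
  proof -
    have "norm r \<le> (1 / 2) * (norm p + norm q)"
      unfolding r_def norm_scale using norm_triangle_ineq[of p q] by simp
    then show ?thesis using qp by simp
  qed
  \<comment> \<open>One factor \<open>norm p\<close> cancels at the end because \<open>r\<close> is
    the midpoint of two elements of norm \<open>norm p\<close>.\<close>
  have "norm p * norm p \<le> norm x * norm r"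
    using norm_mult_le[of "star x" r] cstar_identity[of p] pp by (simp add: norm_star power2_eq_square)
  also have "\<dots> \<le> norm x * norm p" using \<open>norm r \<le> norm p\<close> by (intro mult_left_mono) auto
  finally show ?thesis unfolding x_def[symmetric]
    by (cases "p = 0") auto
qed

text \<open>For a real number t, the modulus of \<open>t / (1 + ist)\<close> is at most
  \<open>1 / s\<close>. Here \<open>ish\<close> times \<open>star h\<close> is the difference of
  \<open>star h\<close> and an element of no larger norm; its norm is \<open>s * (norm h)^2\<close>,
  and the triangle inequality produces the factor 2.\<close>

lemma truncation_norm_le:
  assumes a: "star a = a" and s: "0 < s" and h: "h + smul (\<i> * of_real s) (amul a h) = a"
  shows "norm h \<le> 2 / s"
proof (cases "h = 0")
  case False
  \<comment> \<open>\<open>1 - ish\<close> is inverse to \<open>1 + isa\<close>, hence a contraction.\<close>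
  let ?x = "star h"
  let ?u = "?x - smul (\<i> * of_real s) (amul h ?x)"
  have "amul h ?x + smul (\<i> * of_real s) (amul a (amul h ?x)) = amul a ?x"
    using arg_cong[OF h, of "\<lambda>v. amul v ?x"] by (simp add: mult_add_left mult_scale_left mult_assoc)
  then have "smul (\<i> * of_real s) (amul a ?x) = smul (\<i> * of_real s) (amul h ?x) +
      smul (\<i> * of_real s) (smul (\<i> * of_real s) (amul a (amul h ?x)))"
    by (metis scale_right_distrib)
  then have u: "?u + smul (\<i> * of_real s) (amul a ?u) = ?x"
    by (simp only: mult_diff_right mult_scale_right scale_right_diff_distrib) simp
  have "norm ?u \<le> norm ?x" using norm_le_norm_resolvent[OF a, of ?u s] unfolding u .
  then have "norm (?x - ?u) \<le> 2 * norm ?x" using norm_triangle_ineq4[of ?x ?u] by simp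
  moreover have "norm (?x - ?u) = s * (norm h)\<^sup>2"
    using cstar_identity[of "star h"] s by (simp add: norm_scale norm_mult star_star norm_star)
  ultimately have "s * (norm h)\<^sup>2 \<le> 2 * norm h" by (simp add: norm_star)
  then show ?thesis using False s by (simp add: power2_eq_square field_simps)
qed (use s in simp)

text \<open>Applying \<open>1 + isa\<close>, which does not decrease norms, to \<open>h - b\<close>
  gives \<open>(a - b) - isab\<close>. So truncation costs little near a fixed \<open>b\<close> when
  \<open>s\<close> is small.\<close>

lemma truncation_approx:
  assumes a: "star a = a" and s: "0 < s" and h: "h + smul (\<i> * of_real s) (amul a h) = a"
  shows "norm (h - b) \<le> norm (a - b) + s * norm a * norm b"
proof -
  have eq: "(h - b) + smul (\<i> * of_real s) (amul a (h - b)) = (a - b) - smul (\<i> * of_real s) (amul a b)"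
    using h by (simp add: mult_diff_right scale_right_diff_distrib algebra_simps)
  have "norm (h - b) \<le> norm ((a - b) - smul (\<i> * of_real s) (amul a b))"
    using norm_le_norm_resolvent[OF a, of "h - b" s] unfolding eq .
  also have "\<dots> \<le> norm (a - b) + norm (smul (\<i> * of_real s) (amul a b))" by (rule norm_triangle_ineq4)
  also have "norm (smul (\<i> * of_real s) (amul a b)) \<le> s * (norm a * norm b)"
    using s norm_mult_le[of a b] by (simp add: norm_scale norm_mult)
  finally show ?thesis by (simp add: mult.assoc)
qed

definition re :: "'e \<Rightarrow> 'e" where "re x = smul (1 / 2) x + smul (1 / 2) (star x)"
definition im :: "'e \<Rightarrow> 'e" where "im x = smul (- \<i> / 2) x + smul (\<i> / 2) (star x)"

lemma star_re: "star (re x) = re x" and star_im: "star (im x) = im x"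
  by (simp_all add: re_def im_def star_add star_diff star_scale star_star algebra_simps)

lemma re_im: "re x + smul \<i> (im x) = x"
proof -
  have "re x + smul \<i> (im x) = smul (1 / 2) x + smul (1 / 2) x"
    by (simp add: re_def im_def scale_right_distrib scale_right_diff_distrib scale_minus_left)
  then show ?thesis by (simp add: scale_left_distrib[symmetric])
qed

lemma re_diff: "re (x - y) = re x - re y" and im_diff: "im (x - y) = im x - im y"
  by (simp_all add: re_def im_def star_diff scale_right_diff_distrib)

lemma norm_re_le: "norm (re x) \<le> norm x" and norm_im_le: "norm (im x) \<le> norm x"
  using norm_triangle_ineq[of "smul (1 / 2) x" "smul (1 / 2) (star x)"]
    norm_triangle_ineq[of "smul (- \<i> / 2) x" "smul (\<i> / 2) (star x)"]
  by (simp_all add: re_def im_def norm_scale norm_star norm_divide)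

end

section \<open>Truncation within a *-subalgebra of functions\<close>

locale star_subalgebra = cstar_algebra smul amul star
  for smul :: "complex \<Rightarrow> 'e::banach \<Rightarrow> 'e" and amul star +
  fixes K :: "('a::topological_space \<Rightarrow>\<^sub>C 'e) set"
  assumes star_subalgebra: "star_subalgebra_C0 smul amul star K"
begin

lemma zero_mem: "0 \<in> K"
  and add_mem: "f \<in> K \<Longrightarrow> g \<in> K \<Longrightarrow> f + g \<in> K"
  and smul_mem: "f \<in> K \<Longrightarrow> \<exists>h\<in>K. \<forall>x. apply_bcontfun h x = smul c (apply_bcontfun f x)"
  and amul_mem: "f \<in> K \<Longrightarrow> g \<in> K \<Longrightarrow>
    \<exists>h\<in>K. \<forall>x. apply_bcontfun h x = amul (apply_bcontfun f x) (apply_bcontfun g x)"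
  and star_mem: "f \<in> K \<Longrightarrow> \<exists>h\<in>K. \<forall>x. apply_bcontfun h x = star (apply_bcontfun f x)"
  using star_subalgebra by (simp_all add: star_subalgebra_C0_def)

lemma lincomb_mem:
  assumes "f \<in> K" "g \<in> K"
  shows "\<exists>h\<in>K. \<forall>x. apply_bcontfun h x = smul c (apply_bcontfun f x) + smul d (apply_bcontfun g x)"
proof -
  obtain f' g' where "f' \<in> K" "\<forall>x. apply_bcontfun f' x = smul c (apply_bcontfun f x)"
    "g' \<in> K" "\<forall>x. apply_bcontfun g' x = smul d (apply_bcontfun g x)"
    using smul_mem assms by metis
  then show ?thesis using add_mem by (intro bexI[of _ "f' + g'"]) auto
qed

lemma relax_mem:
  assumes "k \<in> K" "q \<in> K"
  shows "\<exists>h\<in>K. \<forall>x. apply_bcontfun h x =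
    relax c s (apply_bcontfun k x) (apply_bcontfun k x) (apply_bcontfun q x)"
proof -
  obtain m where m: "m \<in> K" "\<And>x. apply_bcontfun m x = amul (apply_bcontfun k x) (apply_bcontfun q x)"
    using amul_mem assms by metis
  obtain u where u: "u \<in> K" "\<And>x. apply_bcontfun u x = smul (of_real (1 - 1 / c)) (apply_bcontfun q x)
      + smul (\<i> * of_real (- s / c)) (apply_bcontfun m x)"
    using lincomb_mem[OF assms(2) m(1)] by metis
  obtain v where v: "v \<in> K" "\<And>x. apply_bcontfun v x = smul (of_real (1 / c)) (apply_bcontfun k x)"
    using smul_mem assms by metis
  show ?thesis
    by (rule bexI[OF _ add_mem[OF u(1) v(1)]]) (simp add: relax_def u v m)
qed

text \<open>The pointwise solution \<open>y\<close> need not belong to \<open>K\<close>, but the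
  iterates starting from 0 do. As \<open>norm k\<close> bounds all values of \<open>k\<close>, the
  rate \<open>\<rho>\<close> is independent of \<open>x\<close>, and the initial error is at most
  \<open>2 / s\<close>; so one iterate is within \<open>\<eta>\<close> of \<open>y\<close>
  everywhere.\<close>

lemma truncation:
  assumes k: "k \<in> K" "\<And>x. star (apply_bcontfun k x) = apply_bcontfun k x" and s: "0 < s" and \<eta>: "0 < \<eta>"
  obtains h where "h \<in> K" "\<And>x. norm (apply_bcontfun h x) \<le> 2 / s + \<eta>"
    "\<And>x b. norm (apply_bcontfun h x - b) \<le>
      \<eta> + (norm (apply_bcontfun k x - b) + s * norm (apply_bcontfun k x) * norm b)"
proof -
  define c where "c = 1 + s\<^sup>2 * (norm k)\<^sup>2"
  define \<rho> where "\<rho> = sqrt (1 - 1 / c)"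
  have c: "1 \<le> c" by (simp add: c_def)
  have \<rho>: "0 \<le> \<rho>" "\<rho> < 1" using c by (auto simp: \<rho>_def)
  let ?T = "\<lambda>x. relax c s (apply_bcontfun k x) (apply_bcontfun k x)"
  have contr: "dist (?T x p) (?T x q) \<le> \<rho> * dist p q" for x p q
    unfolding \<rho>_def by (rule relax_contraction[OF k(2) norm_bounded c_def])
  have "\<exists>h\<in>K. \<forall>x. apply_bcontfun h x = (?T x ^^ n) 0" for n
  proof (induction n)
    case 0
    then show ?case using zero_mem by (intro bexI[of _ 0]) auto
  next
    case (Suc n)
    then obtain h where h: "h \<in> K" "\<forall>x. apply_bcontfun h x = (?T x ^^ n) 0" by blast
    then show ?case using relax_mem[OF k(1) h(1), of c s] by simp
  qed
  then obtain H where H: "\<And>n. H n \<in> K" "\<And>n x. apply_bcontfun (H n) x = (?T x ^^ n) 0"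
    by metis
  have "\<exists>y. ?T x y = y" for x
    using banach_fix_type[of \<rho> "?T x"] \<rho> contr by blast
  then obtain y where y: "\<And>x. ?T x (y x) = y x" by metis
  have y_eq: "y x + smul (\<i> * of_real s) (amul (apply_bcontfun k x) (y x)) = apply_bcontfun k x" for x
    using c by (intro relax_fixpoint[OF _ y]) simp
  have y_norm: "norm (y x) \<le> 2 / s" for x
    by (rule truncation_norm_le[OF k(2) s y_eq])
  have conv: "dist (apply_bcontfun (H n) x) (y x) \<le> \<rho> ^ n * (2 / s)" for n x
  proof (induction n)
    case 0
    then show ?case using y_norm by (simp add: H)
  next
    case (Suc n)
    have "dist (apply_bcontfun (H (Suc n)) x) (y x) = dist (?T x (apply_bcontfun (H n) x)) (?T x (y x))"
      by (simp add: H y)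
    also have "\<dots> \<le> \<rho> * dist (apply_bcontfun (H n) x) (y x)" by (rule contr)
    also have "\<dots> \<le> \<rho> * (\<rho> ^ n * (2 / s))" using Suc \<rho> by (intro mult_left_mono)
    finally show ?case by simp
  qed
  obtain n where n: "\<rho> ^ n < \<eta> * s / 2"
    using real_arch_pow_inv[of "\<eta> * s / 2" \<rho>] \<rho> s \<eta> by auto
  have close: "norm (apply_bcontfun (H n) x - y x) \<le> \<eta>" for x
  proof -
    have "\<rho> ^ n * (2 / s) \<le> \<eta>" using n s by (simp add: field_simps)
    then show ?thesis using conv[of n x] by (simp add: dist_norm)
  qed
  show thesis
  proof (rule that)
    show "H n \<in> K" by (rule H)
    show "norm (apply_bcontfun (H n) x) \<le> 2 / s + \<eta>" for x
      using norm_triangle_ineq[of "apply_bcontfun (H n) x - y x" "y x"] close[of x] y_norm[of x] by simp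
    show "norm (apply_bcontfun (H n) x - b) \<le>
        \<eta> + (norm (apply_bcontfun k x - b) + s * norm (apply_bcontfun k x) * norm b)" for x b
      using norm_triangle_ineq[of "apply_bcontfun (H n) x - y x" "y x - b"] close[of x]
        truncation_approx[OF k(2) s y_eq, of x b] by simp
  qed
qed

text \<open>The point is that \<open>C\<close> is obtained before \<open>L\<close> and
  \<open>k\<close>: it is twice the bound \<open>2 / s + \<epsilon>\<close> for the truncated
  self-adjoint parts, with \<open>s\<close> depending on \<open>f\<close> and
  \<open>\<epsilon>\<close> only.\<close>

lemma bounded_approx:
  assumes \<epsilon>: "0 < \<epsilon>"
  obtains C where "\<And>L k. k \<in> K \<Longrightarrow> (\<And>x. x \<in> L \<Longrightarrow> norm (apply_bcontfun f x - apply_bcontfun k x) \<le> \<epsilon>) \<Longrightarrow>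
    \<exists>h\<in>K. norm h \<le> C \<and> (\<forall>x\<in>L. norm (apply_bcontfun f x - apply_bcontfun h x) \<le> 6 * \<epsilon>)"
proof -
  define M where "M = norm f"
  \<comment> \<open>Chosen so that \<open>s * norm a * norm b \<le> \<epsilon>\<close> if
    \<open>norm a \<le> M + \<epsilon>\<close> and \<open>norm b \<le> M\<close>; the factor
    \<open>M + 1\<close> keeps \<open>s\<close> positive when \<open>M = 0\<close>.\<close>
  define s where "s = \<epsilon> / ((M + \<epsilon>) * (M + 1))"
  have M: "0 \<le> M" by (simp add: M_def)
  have s: "0 < s" using \<epsilon> M by (simp add: s_def)
  have sM: "s * (M + \<epsilon>) * M \<le> \<epsilon>"
  proof -
    have "s * (M + \<epsilon>) * M \<le> s * (M + \<epsilon>) * (M + 1)" using s M \<epsilon> by (intro mult_left_mono) auto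
    also have "\<dots> = \<epsilon>" using M \<epsilon> by (simp add: s_def)
    finally show ?thesis .
  qed
  \<comment> \<open>One \<open>\<epsilon>\<close> each for the unfinished iteration, the distance
    from \<open>a\<close> to \<open>b\<close>, and the truncation.\<close>
  have part: "norm (v - b) \<le> 3 * \<epsilon>"
    if v: "norm (v - b) \<le> \<epsilon> + (norm (a - b) + s * norm a * norm b)" and ab: "norm (a - b) \<le> \<epsilon>" "norm b \<le> M"
    for v a b :: 'e
  proof -
    have "norm a \<le> M + \<epsilon>" using norm_triangle_ineq[of "a - b" b] ab by simp
    then have "s * norm a * norm b \<le> s * (M + \<epsilon>) * M" using s ab M \<epsilon> by (intro mult_mono) auto
    then show ?thesis using v ab sM by simp
  qed
  show thesis
  proof (rule that)
    fix L k assume k: "k \<in> K" and close: "\<And>x. x \<in> L \<Longrightarrow> norm (apply_bcontfun f x - apply_bcontfun k x) \<le> \<epsilon>"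
    obtain k' where k': "k' \<in> K" "\<And>x. apply_bcontfun k' x = star (apply_bcontfun k x)"
      using star_mem[OF k] by metis
    obtain k1 where k1: "k1 \<in> K" "\<And>x. apply_bcontfun k1 x = re (apply_bcontfun k x)"
      using lincomb_mem[OF k k'(1)] unfolding re_def k'(2) by metis
    obtain k2 where k2: "k2 \<in> K" "\<And>x. apply_bcontfun k2 x = im (apply_bcontfun k x)"
      using lincomb_mem[OF k k'(1)] unfolding im_def k'(2) by metis
    obtain h1 where h1: "h1 \<in> K" "\<And>x. norm (apply_bcontfun h1 x) \<le> 2 / s + \<epsilon>"
      "\<And>x b. norm (apply_bcontfun h1 x - b) \<le>
        \<epsilon> + (norm (apply_bcontfun k1 x - b) + s * norm (apply_bcontfun k1 x) * norm b)"
      using truncation[OF k1(1) _ s \<epsilon>] by (auto simp: k1 star_re)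
    obtain h2 where h2: "h2 \<in> K" "\<And>x. norm (apply_bcontfun h2 x) \<le> 2 / s + \<epsilon>"
      "\<And>x b. norm (apply_bcontfun h2 x - b) \<le>
        \<epsilon> + (norm (apply_bcontfun k2 x - b) + s * norm (apply_bcontfun k2 x) * norm b)"
      using truncation[OF k2(1) _ s \<epsilon>] by (auto simp: k2 star_im)
    obtain h where h: "h \<in> K" "\<And>x. apply_bcontfun h x = smul 1 (apply_bcontfun h1 x) + smul \<i> (apply_bcontfun h2 x)"
      using lincomb_mem[OF h1(1) h2(1)] by metis
    have "norm h \<le> (2 / s + \<epsilon>) + (2 / s + \<epsilon>)"
    proof (rule norm_bound)
      show "norm (apply_bcontfun h x) \<le> (2 / s + \<epsilon>) + (2 / s + \<epsilon>)" for x
        unfolding h(2) using h1(2)[of x] h2(2)[of x]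
        by (intro order_trans[OF norm_triangle_ineq] add_mono) (auto simp: norm_scale)
    qed
    moreover have "norm (apply_bcontfun f x - apply_bcontfun h x) \<le> 6 * \<epsilon>" if x: "x \<in> L" for x
    proof -
      let ?f = "apply_bcontfun f x" and ?k = "apply_bcontfun k x"
      have f: "norm ?f \<le> M" unfolding M_def by (rule norm_bounded)
      have fk: "norm (?k - ?f) \<le> \<epsilon>" using close[OF x] by (simp add: norm_minus_commute)
      have 1: "norm (apply_bcontfun h1 x - re ?f) \<le> 3 * \<epsilon>"
        using h1(3)[of x "re ?f"] norm_re_le[of "?k - ?f"] norm_re_le[of ?f] f fk
        by (intro part[of _ _ "apply_bcontfun k1 x"]) (auto simp: k1 re_diff)
      have 2: "norm (apply_bcontfun h2 x - im ?f) \<le> 3 * \<epsilon>"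
        using h2(3)[of x "im ?f"] norm_im_le[of "?k - ?f"] norm_im_le[of ?f] f fk
        by (intro part[of _ _ "apply_bcontfun k2 x"]) (auto simp: k2 im_diff)
      have "apply_bcontfun h x - ?f = (apply_bcontfun h1 x - re ?f) + smul \<i> (apply_bcontfun h2 x - im ?f)"
        using re_im[of ?f] by (simp add: h scale_right_diff_distrib algebra_simps)
      then have "norm (apply_bcontfun h x - ?f) \<le> 6 * \<epsilon>"
        using norm_triangle_ineq[of "apply_bcontfun h1 x - re ?f" "smul \<i> (apply_bcontfun h2 x - im ?f)"] 1 2
        by (simp add: norm_scale)
      then show ?thesis by (simp add: norm_minus_commute)
    qed
    ultimately show "\<exists>h\<in>K. norm h \<le> (2 / s + \<epsilon>) + (2 / s + \<epsilon>) \<and>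
        (\<forall>x\<in>L. norm (apply_bcontfun f x - apply_bcontfun h x) \<le> 6 * \<epsilon>)"
      using h(1) by blast
  qed
qed

end


section \<open>The closure of a convex set\<close>

text \<open>A norm-convergent sequence is bounded and converges pointwise in norm, hence weakly, so
  a single application of (M1) suffices.\<close>

lemma (in banach_space_over) closure_subset_M_hull:
  fixes K :: "('a::topological_space \<Rightarrow>\<^sub>C 'e) set"
  assumes "f \<in> closure K"
  shows "restrict (apply_bcontfun f) L \<in> M_hull smul L ((\<lambda>g. restrict (apply_bcontfun g) L) ` K)"
    (is "_ \<in> M_hull smul L ?A")
proof -
  obtain u where u: "\<And>n. u n \<in> K" "u \<longlonglongrightarrow> f"
    using assms unfolding closure_sequential by blast
  have A: "?A \<subseteq> linfty L" using restrict_bcontfun_linfty by blast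
  obtain C where C: "\<And>n. norm (u n) \<le> C"
    using convergent_imp_bounded[OF u(2)] by (auto simp: bounded_iff)
  have "restrict (apply_bcontfun (u n)) L \<in> M_hull smul L ?A" for n
    using M_hull_smallest(1)[OF A, of smul] u(1) by blast
  moreover have "\<exists>C. \<forall>n. \<forall>z\<in>L. norm (restrict (apply_bcontfun (u n)) L z) \<le> C"
    using order_trans[OF norm_bounded C] by (intro exI[of _ C]) simp
  moreover have "limitin (weak_topology smul) (\<lambda>n. restrict (apply_bcontfun (u n)) L z)
      (restrict (apply_bcontfun f) L z) sequentially" if "z \<in> L" for z
    using tendsto_uniform_limitI[OF tendsto_bcontfun_uniform_limit[OF u(2)], of z] that
    by (intro tendsto_imp_limitin_weak) simp
  ultimately show ?thesis
    using M_hull_smallest(3)[OF A, of smul, unfolded weakly_seq_closed_def, rule_format,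
        of "\<lambda>n. restrict (apply_bcontfun (u n)) L" "restrict (apply_bcontfun f) L"] restrict_bcontfun_linfty[of f L]
    by simp
qed

lemma closed_C0: "closed (C0 :: ('a::topological_space \<Rightarrow>\<^sub>C 'e::real_normed_vector) set)"
proof -
  have "f \<in> C0" if "f \<in> closure C0" for f :: "'a \<Rightarrow>\<^sub>C 'e"
    unfolding C0_def
  proof (intro CollectI allI impI)
    fix e :: real assume e: "0 < e"
    then obtain g where g: "g \<in> C0" "dist g f < e / 2"
      using \<open>f \<in> closure C0\<close> unfolding closure_approachable by (metis half_gt_zero)
    obtain S where S: "compact S" "\<And>x. x \<notin> S \<Longrightarrow> norm (apply_bcontfun g x) < e / 2"
      using g(1) e half_gt_zero[OF e] unfolding C0_def by blast
    have "norm (apply_bcontfun f x) < e" if "x \<notin> S" for x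
      using S(2)[OF that] dist_fun_lt_imp_dist_val_lt[OF g(2), of x]
        norm_triangle_ineq2[of "apply_bcontfun f x" "apply_bcontfun g x"]
      by (simp add: dist_norm norm_minus_commute)
    then show "\<exists>S. compact S \<and> (\<forall>x. x \<notin> S \<longrightarrow> norm (apply_bcontfun f x) < e)" using S(1) by blast
  qed
  then show ?thesis using closure_subset_eq by blast
qed

theorem theorem1p5:
  fixes smul :: "'k::real_or_complex \<Rightarrow> 'e::banach \<Rightarrow> 'e"
    and K :: "('a::t2_space \<Rightarrow>\<^sub>C 'e) set"
  assumes "locally_compact_space (euclidean :: 'a topology)"
    and "banach_space_over smul"
    and "K \<subseteq> C0"
    and "convex K"
    and "compact (UNIV :: 'a set)
       \<or> bounded K
       \<or> (\<exists>cmul amul star. cstar_algebra cmul amul star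
            \<and> (\<forall>c x. cmul (to_complex c) x = smul c x)
            \<and> star_subalgebra_C0 cmul amul star K)"
  shows "closure K =
    {f \<in> C0. \<forall>L. compact L \<longrightarrow>
       restrict (apply_bcontfun f) L
         \<in> M_hull smul L ((\<lambda>g. restrict (apply_bcontfun g) L) ` K)}"
proof (intro subset_antisym subsetI CollectI conjI allI impI)
  interpret banach_space_over smul by fact
  fix f assume f: "f \<in> closure K"
  show "f \<in> C0" using f closure_minimal[OF assms(3) closed_C0] by blast
  show "restrict (apply_bcontfun f) L \<in> M_hull smul L ((\<lambda>g. restrict (apply_bcontfun g) L) ` K)" for L
    by (rule closure_subset_M_hull[OF f])
next
  interpret banach_space_over smul by fact
  fix f assume "f \<in> {f \<in> C0. \<forall>L. compact L \<longrightarrow>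
       restrict (apply_bcontfun f) L \<in> M_hull smul L ((\<lambda>g. restrict (apply_bcontfun g) L) ` K)}"
  then have f: "f \<in> C0"
    and hull: "\<And>L. compact L \<Longrightarrow>
      restrict (apply_bcontfun f) L \<in> M_hull smul L ((\<lambda>g. restrict (apply_bcontfun g) L) ` K)"
    by auto
  have approx: "\<exists>k\<in>K. \<forall>x\<in>L. norm (apply_bcontfun f x - apply_bcontfun k x) \<le> e"
    if "compact L" "0 < e" for L e
    using M_hull_approx[OF that(1) assms(4) that(2) hull[OF that(1)]] less_imp_le by blast
  \<comment> \<open>The constant is \<open>3 * 6\<close>: truncation costs a factor 6 and the
    gliding hump a factor 3; the other two cases are fitted to it.\<close>
  have "\<exists>k\<in>K. dist k f \<le> 18 * e" if e: "0 < e" for e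
    using assms(5)
  proof (elim disjE exE conjE)
    assume "compact (UNIV :: 'a set)"
    then obtain k where k: "k \<in> K" "\<And>x. norm (apply_bcontfun f x - apply_bcontfun k x) \<le> e"
      using approx[of UNIV e] e by auto
    have "dist k f \<le> 18 * e"
    proof (rule dist_bound)
      show "dist (apply_bcontfun k x) (apply_bcontfun f x) \<le> 18 * e" for x
        using k(2)[of x] e by (simp add: dist_norm norm_minus_commute)
    qed
    then show ?thesis using k(1) by blast
  next
    assume "bounded K"
    then obtain C where "\<And>k. k \<in> K \<Longrightarrow> norm k \<le> C" by (auto simp: bounded_iff)
    then have "\<exists>k\<in>K. dist k f \<le> 3 * (6 * e)"
      using approx e by (intro gliding_hump[OF assms(4,3) f, of _ C]) fastforce+
    then show ?thesis by simp
  next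
    fix cmul amul star
    assume "cstar_algebra cmul amul star" "star_subalgebra_C0 cmul amul star K"
    then interpret cstar: star_subalgebra cmul amul star K
      by (intro star_subalgebra.intro star_subalgebra_axioms.intro)
    obtain C where C: "\<And>L k. k \<in> K \<Longrightarrow>
      (\<And>x. x \<in> L \<Longrightarrow> norm (apply_bcontfun f x - apply_bcontfun k x) \<le> e) \<Longrightarrow>
      \<exists>h\<in>K. norm h \<le> C \<and> (\<forall>x\<in>L. norm (apply_bcontfun f x - apply_bcontfun h x) \<le> 6 * e)"
      using cstar.bounded_approx[OF e, of f] by blast
    have "\<exists>k\<in>K. dist k f \<le> 3 * (6 * e)"
    proof (rule gliding_hump[OF assms(4,3) f])
      show "\<exists>k\<in>K. norm k \<le> C \<and> (\<forall>x\<in>L. norm (apply_bcontfun f x - apply_bcontfun k x) \<le> 6 * e)"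
        if "compact L" for L
        using approx[OF that e] C by blast
    qed (use e in simp)
    then show ?thesis by simp
  qed
  then have "\<exists>k\<in>K. dist k f < e" if e: "0 < e" for e
  proof -
    obtain k where "k \<in> K" "dist k f \<le> 18 * (e / 36)"
      using \<open>\<And>e. 0 < e \<Longrightarrow> \<exists>k\<in>K. dist k f \<le> 18 * e\<close>[of "e / 36"] e by auto
    then show ?thesis using e by (intro bexI[of _ k]) auto
  qed
  then show "f \<in> closure K" unfolding closure_approachable by blast
qed

end
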